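(* Let $A\in\mathbb{S}^n$ have eigenvalue decomposition $A=V_+\Lambda_+V_+^T+V_-\Lambda_-V_-^T$, where $[V_+\ V_-]$ is an $n\times n$ orthogonal (unitary) matrix and the diagonal matrices $\Lambda_+$, $\Lambda_-$ contain the positive and the non-positive eigenvalues of $A$ respectively. Let $k\le n$, let $\widehat V$ be an $n\times k$ matrix with orthonormal columns, and let $\widehat\Lambda$ be a $k\times k$ positive semidefinite matrix with $\widehat\Lambda=\widehat V^TA\widehat V$. Let $\widehat V_\perp$ be an $n\times(n-k)$ matrix with orthonormal columns spanning the nullspace of $\widehat V^T$. Put $R := A\widehat V-\widehat V\widehat\Lambda$ and $D_+ := \Pi_+(\widehat V_\perp^T A\widehat V_\perp)$. Then $$\|A(V_+V_+^T-\widehat V\widehat V^T)\|_F^2\le 2\|R\|_F^2+2\|R\|_F\|D_+\|_F+\|D_+\|_F^2\le 2\left(\|R\|_F+\|D_+\|_F\right)^2 .$$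
   Context: $\mathbb{S}^n$ is the set of $n\times n$ Hermitian matrices (real symmetric in the real case), and $^T$ denotes the transpose (conjugate transpose in the complex case). $\|\cdot\|_F$ is the Frobenius norm. For a Hermitian matrix $M$, $\Pi_+(M)$ denotes its projection onto the positive semidefinite cone: if $M=W_+\Theta_+W_+^T+W_-\Theta_-W_-^T$ is an eigenvalue decomposition with $[W_+\ W_-]$ orthogonal (unitary) and $\Theta_+$, $\Theta_-$ diagonal containing the positive and the non-positive eigenvalues respectively, then $\Pi_+(M):=W_+\Theta_+W_+^T$. *)

theory Defs
  imports
    "Jordan_Normal_Form.Schur_Decomposition"
    "Jordan_Normal_Form.Matrix_Kernel"
begin

text \<open>Everything is polymorphic so that it can be used at the entry types \<^typ>\<open>real\<close> and
  \<^typ>\<open>complex\<close>. On \<^typ>\<open>complex\<close> the order is the one of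
  \<^theory>\<open>HOL-Library.Complex_Order\<close>, so \<open>0 < z\<close> and \<open>z \<le> 0\<close> include that \<open>z\<close> is real.
  The matrix type is that of \<^theory>\<open>Jordan_Normal_Form.Matrix\<close>; dimensions may be \<open>0\<close>.\<close>

definition frobenius_norm :: "'a :: real_normed_field mat \<Rightarrow> real" where
  "frobenius_norm M = sqrt (\<Sum>i<dim_row M. \<Sum>j<dim_col M. (norm (M $$ (i, j)))\<^sup>2)"

definition hermitian_mat :: "'a :: conjugatable_field mat \<Rightarrow> bool" where
  "hermitian_mat M \<longleftrightarrow> mat_adjoint M = M"

definition orthonormal_cols :: "'a :: conjugatable_field mat \<Rightarrow> bool" where
  "orthonormal_cols V \<longleftrightarrow> mat_adjoint V * V = 1\<^sub>m (dim_col V)"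

definition unitary_mat :: "'a :: conjugatable_field mat \<Rightarrow> bool" where
  "unitary_mat U \<longleftrightarrow> square_mat U \<and> orthonormal_cols U"

text \<open>\<open>(M *\<^sub>v v) \<bullet>c v\<close> is the quadratic form, the sum of \<open>(M v)\<^sub>i\<close> times the conjugate of
  \<open>v\<^sub>i\<close>.\<close>

definition psd_mat :: "'a :: conjugatable_ordered_field mat \<Rightarrow> bool" where
  "psd_mat M \<longleftrightarrow> hermitian_mat M \<and> (\<forall>v \<in> carrier_vec (dim_row M). 0 \<le> (M *\<^sub>v v) \<bullet>c v)"

definition append_cols_mat :: "'a mat \<Rightarrow> 'a mat \<Rightarrow> 'a mat" where
  "append_cols_mat V W = mat_of_cols (dim_row V) (cols V @ cols W)"

text \<open>\<open>M = W\<^sub>+ \<Theta>\<^sub>+ W\<^sub>+\<^sup>* + W\<^sub>- \<Theta>\<^sub>- W\<^sub>-\<^sup>*\<close>, an eigenvalue decomposition grouped into the positive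
  and the non-positive eigenvalues (with multiplicity); either group may be empty.\<close>

definition signed_eigendecomp ::
  "'a :: conjugatable_ordered_field mat \<Rightarrow> 'a mat \<Rightarrow> 'a mat \<Rightarrow> 'a mat \<Rightarrow> 'a mat \<Rightarrow> bool" where
  "signed_eigendecomp M Wp Tp Wm Tm \<longleftrightarrow>
     Wp \<in> carrier_mat (dim_row M) (dim_col Wp) \<and>
     Wm \<in> carrier_mat (dim_row M) (dim_col Wm) \<and>
     unitary_mat (append_cols_mat Wp Wm) \<and>
     Tp \<in> carrier_mat (dim_col Wp) (dim_col Wp) \<and> diagonal_mat Tp \<and>
     (\<forall>i < dim_col Wp. 0 < Tp $$ (i, i)) \<and>
     Tm \<in> carrier_mat (dim_col Wm) (dim_col Wm) \<and> diagonal_mat Tm \<and>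
     (\<forall>i < dim_col Wm. Tm $$ (i, i) \<le> 0) \<and>
     M = Wp * Tp * mat_adjoint Wp + Wm * Tm * mat_adjoint Wm"

text \<open>The projection onto the positive semidefinite cone. For Hermitian \<open>M\<close> a decomposition
  exists by the spectral theorem, and the value is the same for all of them.\<close>

definition psd_proj :: "'a :: conjugatable_ordered_field mat \<Rightarrow> 'a mat" where
  "psd_proj M = (SOME P. \<exists>Wp Tp Wm Tm.
     signed_eigendecomp M Wp Tp Wm Tm \<and> P = Wp * Tp * mat_adjoint Wp)"

end

theory Submission
  imports Defs "HOL-Analysis.L2_Norm"
begin

text \<open>Write \<open>A = P - N\<close> for the decomposition into positive and negative parts, \<open>Q\<close> for
  \<open>Vh Lh Vh\<^sup>H\<close>, and \<open>Vo (Vo\<^sup>H A Vo) Vo\<^sup>H = Z - C\<close> with \<open>Z = Vo Dp Vo\<^sup>H\<close>. Then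
  \<open>A = Q + Z - C + L + L\<^sup>H\<close> with \<open>L = R Vh\<^sup>H\<close>. Put \<open>F = P - (Q + Z)\<close> and \<open>G = C - N\<close>, so that
  \<open>F + G = L + L\<^sup>H\<close>. Since \<open>P N = 0\<close>, \<open>(Q + Z) C = 0\<close> and traces of products of positive
  semidefinite matrices are nonnegative, \<open>tr (F G) \<ge> 0\<close>, which says that
  \<open>\<parallel>F - L\<parallel> \<le> \<parallel>L\<parallel> = \<parallel>R\<parallel>\<close>. As \<open>A (Vp Vp\<^sup>H - Vh Vh\<^sup>H) = P - (L + Q) = (F - L) + Z\<close>, the triangle
  inequality bounds its norm by \<open>\<parallel>R\<parallel> + \<parallel>Dp\<parallel>\<close>, whose square is at most the middle term.\<close>

subsection \<open>Adjoints and real or complex scalars\<close>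

notation mat_adjoint ("_\<^sup>H" [1000] 999)

text \<open>The common setting of \<^typ>\<open>real\<close> and \<^typ>\<open>complex\<close>; it is a locale and not a class because
  an axiom about \<^typ>\<open>'a mat\<close> and \<^const>\<open>of_real\<close> needs the full sort of \<^typ>\<open>'a\<close>.\<close>

locale inner_field =
  fixes ty :: "'a :: {conjugatable_ordered_field, real_normed_field} itself"
  assumes mult_conjugate_eq_norm: "\<And>a :: 'a. a * conjugate a = of_real ((norm a)\<^sup>2)"
    and of_real_le_of_real: "\<And>r s. of_real r \<le> (of_real s :: 'a) \<longleftrightarrow> r \<le> s"
    and nonneg_imp_conjugate: "\<And>a :: 'a. 0 \<le> a \<Longrightarrow> conjugate a = a"
    and conjugate_fixed_imp_real: "\<And>a :: 'a. conjugate a = a \<Longrightarrow> \<exists>r. a = of_real r"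
    and hermitian_eigenvalue: "\<And>(A :: 'a mat) n.
      \<lbrakk>A \<in> carrier_mat n n; hermitian_mat A; 0 < n\<rbrakk> \<Longrightarrow> \<exists>e. eigenvalue A e"

lemma mat_adjoint_dim [simp]:
  "dim_row (A\<^sup>H) = dim_col A" "dim_col (A\<^sup>H) = dim_row A"
  by (simp_all add: mat_adjoint_def)

lemma mat_adjoint_carrier [simp]: "A \<in> carrier_mat r c \<Longrightarrow> A\<^sup>H \<in> carrier_mat c r"
  by (rule carrier_matI) simp_all

lemma mat_adjoint_index [simp]:
  "i < dim_col A \<Longrightarrow> j < dim_row A \<Longrightarrow> A\<^sup>H $$ (i, j) = conjugate (A $$ (j, i))"
  by (simp add: mat_adjoint_def mat_of_rows_index)

lemma mat_adjoint_adjoint [simp]: "(A\<^sup>H)\<^sup>H = A"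
  by (rule eq_matI) auto

lemma mat_adjoint_add:
  "\<lbrakk>A \<in> carrier_mat r c; B \<in> carrier_mat r c\<rbrakk> \<Longrightarrow> (A + B)\<^sup>H = A\<^sup>H + B\<^sup>H"
  by (rule eq_matI) (auto simp: conjugate_dist_add)

lemma conjugate_minus: "conjugate (a - b :: 'a :: conjugatable_ring) = conjugate a - conjugate b"
  using conjugate_dist_add[of a "- b"] by (simp add: conjugate_neg)

lemma mat_adjoint_minus:
  "\<lbrakk>A \<in> carrier_mat r c; B \<in> carrier_mat r c\<rbrakk> \<Longrightarrow> (A - B)\<^sup>H = A\<^sup>H - B\<^sup>H"
  by (rule eq_matI) (auto simp: conjugate_minus)

lemma mat_adjoint_zero [simp]: "(0\<^sub>m r c)\<^sup>H = 0\<^sub>m c r"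
  by (rule eq_matI) auto

lemma mat_adjoint_mult:
  assumes "A \<in> carrier_mat r m" "B \<in> carrier_mat m c"
  shows "(A * B)\<^sup>H = B\<^sup>H * A\<^sup>H"
proof (rule eq_matI)
  fix i j assume "i < dim_row (B\<^sup>H * A\<^sup>H)" "j < dim_col (B\<^sup>H * A\<^sup>H)"
  with assms have ij: "i < c" "j < r"
    by auto
  have "(A * B)\<^sup>H $$ (i, j) = (\<Sum>k<m. conjugate (A $$ (j, k)) * conjugate (B $$ (k, i)))"
    using assms ij by (simp add: scalar_prod_def sum_conjugate conjugate_dist_mul lessThan_atLeast0)
  also have "\<dots> = (\<Sum>k<m. conjugate (B $$ (k, i)) * conjugate (A $$ (j, k)))"
    by (simp only: mult.commute)
  also have "\<dots> = (B\<^sup>H * A\<^sup>H) $$ (i, j)"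
    using assms ij by (simp add: scalar_prod_def lessThan_atLeast0)
  finally show "(A * B)\<^sup>H $$ (i, j) = (B\<^sup>H * A\<^sup>H) $$ (i, j)" .
qed (use assms in auto)

lemma adjoint_mult_vec_cscalar:
  assumes "W \<in> carrier_mat r c" "x \<in> carrier_vec r" "y \<in> carrier_vec c"
  shows "(W\<^sup>H *\<^sub>v x) \<bullet>c y = x \<bullet>c (W *\<^sub>v y)"
proof -
  have "(W\<^sup>H *\<^sub>v x) \<bullet>c y = (\<Sum>j<c. \<Sum>i<r. conjugate (W $$ (i, j)) * x $ i * conjugate (y $ j))"
    using assms by (auto simp: scalar_prod_def sum_distrib_right lessThan_atLeast0)
  also have "\<dots> = (\<Sum>i<r. \<Sum>j<c. conjugate (W $$ (i, j)) * x $ i * conjugate (y $ j))"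
    by (rule sum.swap)
  also have "\<dots> = (\<Sum>i<r. x $ i * conjugate (\<Sum>j<c. W $$ (i, j) * y $ j))"
    by (simp add: sum_conjugate conjugate_dist_mul sum_distrib_left mult_ac)
  also have "\<dots> = x \<bullet>c (W *\<^sub>v y)"
    using assms by (auto simp: scalar_prod_def lessThan_atLeast0)
  finally show ?thesis .
qed

text \<open>Moving \<open>A\<close> across the form \<open>v \<bullet>c v\<close> trades
  \<open>e\<close> for its conjugate, and the form does not vanish at an eigenvector, so it can be
  cancelled.\<close>

lemma hermitian_eigenvalue_conjugate:
  fixes A :: "'a :: conjugatable_ordered_field mat"
  assumes A: "A \<in> carrier_mat n n" and "hermitian_mat A" and ev: "eigenvector A v e"
  shows "conjugate e = e"
proof -
  have v: "v \<in> carrier_vec n" "v \<noteq> 0\<^sub>v n" "A *\<^sub>v v = e \<cdot>\<^sub>v v"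
    using ev A by (auto simp: eigenvector_def)
  have "(A *\<^sub>v v) \<bullet>c v = v \<bullet>c (A *\<^sub>v v)"
    using adjoint_mult_vec_cscalar[OF A v(1) v(1)] assms(2) by (simp add: hermitian_mat_def)
  then have "e * (v \<bullet>c v) = conjugate e * (v \<bullet>c v)"
    using v by (simp add: conjugate_smult_vec)
  moreover have "v \<bullet>c v \<noteq> 0"
    using v by simp
  ultimately show ?thesis by simp
qed

section \<open>Existence of eigenvalues over the complex and the real field\<close>

lemma complex_eigenvalue_exists:
  fixes A :: "complex mat"
  assumes A: "A \<in> carrier_mat n n" and "0 < n"
  shows "\<exists>e. eigenvalue A e"
proof -
  have "degree (char_poly A) \<noteq> 0"
    using degree_monic_char_poly[OF A] assms by simp
  then have "\<exists>z. poly (char_poly A) z = 0"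
    using fundamental_theorem_of_algebra constant_degree by metis
  then show ?thesis
    using eigenvalue_root_char_poly[OF A] by auto
qed

interpretation complex: inner_field "TYPE(complex)"
proof
  fix a :: complex and r s :: real and A :: "complex mat" and n :: nat
  show "a * conjugate a = of_real ((norm a)\<^sup>2)"
    by (simp only: conjugate_complex_def complex_norm_square)
  show "of_real r \<le> (of_real s :: complex) \<longleftrightarrow> r \<le> s"
    by (simp add: less_eq_complex_def)
  show "0 \<le> a \<Longrightarrow> conjugate a = a"
    by (simp add: less_eq_complex_def complex_eq_iff)
  show "conjugate a = a \<Longrightarrow> \<exists>r. a = of_real r"
    by (rule exI[of _ "Re a"]) (simp add: complex_eq_iff)
  show "\<lbrakk>A \<in> carrier_mat n n; hermitian_mat A; 0 < n\<rbrakk> \<Longrightarrow> \<exists>e. eigenvalue A e"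
    by (rule complex_eigenvalue_exists)
qed

text \<open>Complexification keeps the matrix Hermitian, so it has an eigenvalue and that eigenvalue
  is real. The characteristic polynomials correspond under the embedding of the reals, hence the
  same number is a root over the reals.\<close>

lemma real_hermitian_eigenvalue_exists:
  fixes A :: "real mat"
  assumes A: "A \<in> carrier_mat n n" and herm: "hermitian_mat A" and "0 < n"
  shows "\<exists>e. eigenvalue A e"
proof -
  define C where "C = map_mat complex_of_real A"
  have C: "C \<in> carrier_mat n n"
    using A by (simp add: C_def)
  have "hermitian_mat C"
    unfolding hermitian_mat_def
  proof (rule eq_matI)
    fix i j assume "i < dim_row C" "j < dim_col C"
    then have ij: "i < n" "j < n"
      using C by auto
    then have "A $$ (j, i) = A\<^sup>H $$ (i, j)"
      using A by simp
    also have "\<dots> = A $$ (i, j)"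
      using herm by (simp add: hermitian_mat_def)
    finally show "C\<^sup>H $$ (i, j) = C $$ (i, j)"
      using A ij by (simp add: C_def)
  qed (use C in auto)
  moreover obtain e where e: "eigenvalue C e"
    using complex_eigenvalue_exists[OF C \<open>0 < n\<close>] by blast
  ultimately have "cnj e = e"
    using hermitian_eigenvalue_conjugate[OF C] by (auto simp: eigenvalue_def)
  then obtain r where r: "e = complex_of_real r"
    by (metis Reals_cnj_iff Reals_cases)
  have "poly (map_poly complex_of_real (char_poly A)) (complex_of_real r) = 0"
    using e unfolding eigenvalue_root_char_poly[OF C] unfolding r C_def of_real_hom.char_poly_hom[OF A] .
  then have "poly (char_poly A) r = 0"
    by (simp only: of_real_hom.poly_map_poly of_real_eq_0_iff)
  then show ?thesis
    using eigenvalue_root_char_poly[OF A] by blast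
qed

interpretation real: inner_field "TYPE(real)"
proof
  fix a :: real and A :: "real mat" and n :: nat
  show "a * conjugate a = of_real ((norm a)\<^sup>2)"
    by (simp add: power2_eq_square)
  show "conjugate a = a \<Longrightarrow> \<exists>r. a = of_real r"
    by (rule exI[of _ a]) simp
  show "\<lbrakk>A \<in> carrier_mat n n; hermitian_mat A; 0 < n\<rbrakk> \<Longrightarrow> \<exists>e. eigenvalue A e"
    by (rule real_hermitian_eigenvalue_exists)
qed simp_all

subsection \<open>Orthonormal columns and unitary matrices\<close>

text \<open>Both sides share the block sizes, so shifting the row index by \<open>r\<close> or the
  column index by \<open>c\<close> reads the same block off either side. In this way one equation
  with an identity matrix splits into orthogonality relations.\<close>

lemma four_block_mat_inject:
  assumes "A \<in> carrier_mat r c" "B \<in> carrier_mat r d" "C \<in> carrier_mat s c" "D \<in> carrier_mat s d"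
    and "A' \<in> carrier_mat r c" "B' \<in> carrier_mat r d" "C' \<in> carrier_mat s c" "D' \<in> carrier_mat s d"
    and eq: "four_block_mat A B C D = four_block_mat A' B' C' D'"
  shows "A = A'" "B = B'" "C = C'" "D = D'"
proof -
  have entry: "four_block_mat A B C D $$ (i, j) = four_block_mat A' B' C' D' $$ (i, j)" for i j
    by (simp add: eq)
  show "A = A'"
  proof (rule eq_matI)
    fix i j assume "i < dim_row A'" "j < dim_col A'"
    then show "A $$ (i, j) = A' $$ (i, j)"
      using entry[of i j] assms(1-8) by simp
  qed (use assms in auto)
  show "B = B'"
  proof (rule eq_matI)
    fix i j assume "i < dim_row B'" "j < dim_col B'"
    then show "B $$ (i, j) = B' $$ (i, j)"
      using entry[of i "c + j"] assms(1-8) by simp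
  qed (use assms in auto)
  show "C = C'"
  proof (rule eq_matI)
    fix i j assume "i < dim_row C'" "j < dim_col C'"
    then show "C $$ (i, j) = C' $$ (i, j)"
      using entry[of "r + i" j] assms(1-8) by simp
  qed (use assms in auto)
  show "D = D'"
  proof (rule eq_matI)
    fix i j assume "i < dim_row D'" "j < dim_col D'"
    then show "D $$ (i, j) = D' $$ (i, j)"
      using entry[of "r + i" "c + j"] assms(1-8) by simp
  qed (use assms in auto)
qed

section \<open>Concatenated columns as block matrices\<close>

lemma append_cols_mat_carrier:
  assumes "V \<in> carrier_mat n p" "W \<in> carrier_mat n q"
  shows "append_cols_mat V W \<in> carrier_mat n (p + q)"
  using assms by (auto simp: append_cols_mat_def)

text \<open>The lower blocks have no rows. Padding with them turns a concatenation of columns into a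
  two-by-two block matrix, so that the block multiplication rule applies.\<close>

lemma append_cols_mat_eq_four_block:
  assumes "V \<in> carrier_mat n p" "W \<in> carrier_mat n q"
  shows "append_cols_mat V W = four_block_mat V W (0\<^sub>m 0 p) (0\<^sub>m 0 q)"
proof (rule eq_matI)
  fix i j assume "i < dim_row (four_block_mat V W (0\<^sub>m 0 p) (0\<^sub>m 0 q))"
    "j < dim_col (four_block_mat V W (0\<^sub>m 0 p) (0\<^sub>m 0 q))"
  then have "i < n" "j < p + q"
    using assms by auto
  then show "append_cols_mat V W $$ (i, j) = four_block_mat V W (0\<^sub>m 0 p) (0\<^sub>m 0 q) $$ (i, j)"
    using assms by (auto simp: append_cols_mat_def mat_of_cols_index nth_append)
qed (use assms in \<open>auto simp: append_cols_mat_def\<close>)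

lemma mat_adjoint_append_cols:
  assumes "V \<in> carrier_mat n p" "W \<in> carrier_mat n q"
  shows "(append_cols_mat V W)\<^sup>H = four_block_mat (V\<^sup>H) (0\<^sub>m p 0) (W\<^sup>H) (0\<^sub>m q 0)"
    (is "_ = ?R")
  unfolding append_cols_mat_eq_four_block[OF assms]
proof (rule eq_matI)
  fix i j assume "i < dim_row ?R" "j < dim_col ?R"
  then have "i < p + q" "j < n"
    using assms by auto
  then show "(four_block_mat V W (0\<^sub>m 0 p) (0\<^sub>m 0 q))\<^sup>H $$ (i, j) = ?R $$ (i, j)"
    using assms by simp
qed (use assms in auto)

lemma append_cols_gram:
  assumes V: "V \<in> carrier_mat n p" and W: "W \<in> carrier_mat n q"
  shows "(append_cols_mat V W)\<^sup>H * append_cols_mat V W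
    = four_block_mat (V\<^sup>H * V) (V\<^sup>H * W) (W\<^sup>H * V) (W\<^sup>H * W)"
  unfolding mat_adjoint_append_cols[OF assms] unfolding append_cols_mat_eq_four_block[OF assms]
  using V W by (subst mult_four_block_mat[of _ p n _ 0 _ q _ _ p _ q]) auto

text \<open>With identity matrices for \<open>S\<close> and \<open>T\<close> this becomes the
  resolution of the identity; with diagonal ones it merges two groups of eigenvectors into
  one.\<close>

lemma append_cols_sandwich:
  assumes V: "V \<in> carrier_mat n p" and W: "W \<in> carrier_mat n q"
    and S: "S \<in> carrier_mat p p" and T: "T \<in> carrier_mat q q"
  shows "append_cols_mat V W * four_block_mat S (0\<^sub>m p q) (0\<^sub>m q p) T * (append_cols_mat V W)\<^sup>H
    = V * S * V\<^sup>H + W * T * W\<^sup>H"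
proof -
  have "append_cols_mat V W * four_block_mat S (0\<^sub>m p q) (0\<^sub>m q p) T
    = four_block_mat (V * S) (W * T) (0\<^sub>m 0 p) (0\<^sub>m 0 q)"
    unfolding append_cols_mat_eq_four_block[OF V W]
    using assms by (subst mult_four_block_mat[of _ n p _ q _ 0 _ _ p _ q]) auto
  \<comment> \<open>The left factor has empty lower blocks and the right factor empty right-hand
    blocks, so the product is an \<open>n\<close> by \<open>n\<close> block with an empty
    border.\<close>
  moreover have "four_block_mat (V * S) (W * T) (0\<^sub>m 0 p) (0\<^sub>m 0 q)
      * four_block_mat (V\<^sup>H) (0\<^sub>m p 0) (W\<^sup>H) (0\<^sub>m q 0)
    = four_block_mat (V * S * V\<^sup>H + W * T * W\<^sup>H) (0\<^sub>m n 0) (0\<^sub>m 0 n) (0\<^sub>m 0 0)"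
    using assms by (subst mult_four_block_mat[of _ n p _ q _ 0 _ _ n _ 0]) auto
  moreover have "\<dots> = V * S * V\<^sup>H + W * T * W\<^sup>H"
    using assms by (intro eq_matI) auto
  ultimately show ?thesis
    by (simp add: mat_adjoint_append_cols[OF V W])
qed

text \<open>Squareness amounts to \<open>p + q = n\<close>, and comparing the blocks of the Gram
  matrix with those of the identity gives the rest; the block \<open>W\<^sup>H * V\<close> is the
  adjoint of \<open>V\<^sup>H * W\<close>.\<close>

lemma unitary_append_cols_iff:
  assumes V: "V \<in> carrier_mat n p" and W: "W \<in> carrier_mat n q"
  shows "unitary_mat (append_cols_mat V W)
    \<longleftrightarrow> p + q = n \<and> V\<^sup>H * V = 1\<^sub>m p \<and> W\<^sup>H * W = 1\<^sub>m q \<and> V\<^sup>H * W = 0\<^sub>m p q"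
    (is "?L \<longleftrightarrow> ?R")
proof -
  have WV: "V\<^sup>H * W = 0\<^sub>m p q \<Longrightarrow> W\<^sup>H * V = 0\<^sub>m q p"
    using mat_adjoint_mult[of "V\<^sup>H" p n W q] V W by simp
  have L: "?L \<longleftrightarrow> p + q = n \<and>
      four_block_mat (V\<^sup>H * V) (V\<^sup>H * W) (W\<^sup>H * V) (W\<^sup>H * W) = 1\<^sub>m (p + q)"
    using append_cols_mat_carrier[OF V W] append_cols_gram[OF V W]
    by (auto simp: unitary_mat_def orthonormal_cols_def)
  show ?thesis
  proof
    assume ?L
    then have pq: "p + q = n" and eq: "four_block_mat (V\<^sup>H * V) (V\<^sup>H * W) (W\<^sup>H * V) (W\<^sup>H * W)
        = four_block_mat (1\<^sub>m p) (0\<^sub>m p q) (0\<^sub>m q p) (1\<^sub>m q)"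
      using L by simp_all
    have carr: "V\<^sup>H * V \<in> carrier_mat p p" "V\<^sup>H * W \<in> carrier_mat p q"
      "W\<^sup>H * V \<in> carrier_mat q p" "W\<^sup>H * W \<in> carrier_mat q q"
      using V W by (simp_all add: mult_carrier_mat[of _ _ n])
    show ?R
      using pq four_block_mat_inject[OF carr one_carrier_mat zero_carrier_mat zero_carrier_mat
          one_carrier_mat eq] by blast
  next
    assume ?R
    then show ?L
      using L WV by simp
  qed
qed

text \<open>For a square matrix a left inverse is also a right inverse, so the Gram equation turns
  into \<open>U * U\<^sup>H = 1\<^sub>m n\<close>, which expands into the two orthogonal
  projectors.\<close>

lemma unitary_append_cols_resolution:
  assumes V: "V \<in> carrier_mat n p" and W: "W \<in> carrier_mat n q"
    and unit: "unitary_mat (append_cols_mat V W)"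
  shows "V * V\<^sup>H + W * W\<^sup>H = 1\<^sub>m n"
proof -
  define U where "U = append_cols_mat V W"
  have pq: "p + q = n"
    using unit unitary_append_cols_iff[OF V W] by blast
  then have U: "U \<in> carrier_mat n n"
    using append_cols_mat_carrier[OF V W] by (simp add: U_def)
  then have "U * U\<^sup>H = 1\<^sub>m n"
    using unit mat_mult_left_right_inverse[of "U\<^sup>H" n U]
    by (auto simp: U_def unitary_mat_def orthonormal_cols_def)
  moreover have "U * 1\<^sub>m n * U\<^sup>H = V * 1\<^sub>m p * V\<^sup>H + W * 1\<^sub>m q * W\<^sup>H"
    using append_cols_sandwich[OF V W, of "1\<^sub>m p" "1\<^sub>m q"] by (simp add: U_def pq)
  ultimately show ?thesis
    using U V W by simp
qed

lemma append_cols_adjoint_mult_zero: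
  assumes V: "V \<in> carrier_mat n p" and W: "W \<in> carrier_mat n q" and Z: "Z \<in> carrier_mat n r"
    and "V\<^sup>H * Z = 0\<^sub>m p r" "W\<^sup>H * Z = 0\<^sub>m q r"
  shows "(append_cols_mat V W)\<^sup>H * Z = 0\<^sub>m (p + q) r"
proof -
  have "(append_cols_mat V W)\<^sup>H * four_block_mat Z (0\<^sub>m n 0) (0\<^sub>m 0 r) (0\<^sub>m 0 0)
    = four_block_mat (0\<^sub>m p r) (0\<^sub>m p 0) (0\<^sub>m q r) (0\<^sub>m q 0)"
    unfolding mat_adjoint_append_cols[OF V W]
    using assms by (subst mult_four_block_mat[of _ p n _ 0 _ q _ _ r _ 0]) auto
  moreover have "four_block_mat Z (0\<^sub>m n 0) (0\<^sub>m 0 r) (0\<^sub>m 0 0) = Z"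
    using Z by (intro eq_matI) auto
  ultimately show ?thesis by simp
qed

lemma mult_col_scaled:
  assumes "A \<in> carrier_mat n n" "X \<in> carrier_mat n 1" "A *\<^sub>v col X 0 = e \<cdot>\<^sub>v col X 0"
  shows "A * X = e \<cdot>\<^sub>m X"
proof (rule eq_matI)
  fix i j assume "i < dim_row (e \<cdot>\<^sub>m X)" "j < dim_col (e \<cdot>\<^sub>m X)"
  then have "i < n" "j = 0"
    using assms by auto
  then show "(A * X) $$ (i, j) = (e \<cdot>\<^sub>m X) $$ (i, j)"
    using assms(1,2) arg_cong[OF assms(3), of "\<lambda>w. w $ i"] by simp
qed (use assms in auto)

section \<open>Normalisation and completion to a unitary matrix\<close>

context inner_field
begin

text \<open>\<open>nonneg_imp_conjugate\<close> covers the nonnegative reals; a negative one is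
  treated through its opposite.\<close>

lemma conjugate_of_real: "conjugate (of_real r :: 'a) = of_real r"
proof (cases "0 \<le> r")
  case True
  then show ?thesis
    using of_real_le_of_real[of 0 r] nonneg_imp_conjugate by simp
next
  case False
  then have "conjugate (of_real (- r) :: 'a) = of_real (- r)"
    using of_real_le_of_real[of 0 "- r"] by (intro nonneg_imp_conjugate) simp
  then show ?thesis by (simp add: conjugate_neg)
qed

lemma nonneg_imp_real: "0 \<le> (a :: 'a) \<Longrightarrow> \<exists>r\<ge>0. a = of_real r"
  using nonneg_imp_conjugate conjugate_fixed_imp_real of_real_le_of_real[of 0] by fastforce

lemma normalize_vec:
  assumes w: "(w :: 'a vec) \<in> carrier_vec n" "w \<noteq> 0\<^sub>v n"
  shows "\<exists>c. c \<noteq> 0 \<and> (c \<cdot>\<^sub>v w) \<bullet>c (c \<cdot>\<^sub>v w) = 1"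
proof -
  obtain s where s: "0 \<le> s" "w \<bullet>c w = of_real s"
    using nonneg_imp_real[of "w \<bullet>c w"] w by auto
  with w have "0 < s"
    by (metis conjugate_square_eq_0_vec of_real_0 order_less_le)
  define c :: 'a where "c = of_real (1 / sqrt s)"
  have "(c \<cdot>\<^sub>v w) \<bullet>c (c \<cdot>\<^sub>v w) = c * (c * of_real s)"
    using w(1) conjugate_of_real[of "1 / sqrt s"]
    by (simp add: conjugate_smult_vec s(2) c_def del: of_real_divide)
  also have "\<dots> = of_real (1 / sqrt s * (1 / sqrt s) * s)"
    by (simp only: c_def of_real_mult mult.assoc)
  also have "1 / sqrt s * (1 / sqrt s) * s = 1"
    using \<open>0 < s\<close> by (simp add: field_simps)
  finally show ?thesis
    using \<open>0 < s\<close> by (intro exI[of _ c]) (simp add: c_def)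
qed

text \<open>Gram-Schmidt is applied to a completed basis and leaves the first vector alone. For
  \<open>i = j\<close> the equivalence records that no \<open>ws ! i\<close> vanishes, which permits
  normalising.\<close>

lemma orthogonal_completion:
  assumes v: "(v :: 'a vec) \<in> carrier_vec n" "v \<noteq> 0\<^sub>v n"
  shows "\<exists>ws. set ws \<subseteq> carrier_vec n \<and> length ws = n \<and> hd ws = v \<and>
    (\<forall>i < n. \<forall>j < n. ws ! i \<bullet>c ws ! j = 0 \<longleftrightarrow> i \<noteq> j)"
proof -
  interpret cof_vec_space n "TYPE('a)" .
  note b = basis_completion[OF v]
  note gs = gram_schmidt_result[OF b(2,4,5) refl]
  have "basis_completion v = v # tl (basis_completion v)"
    by (simp add: basis_completion_def Let_def)
  then have "hd (gram_schmidt n (basis_completion v)) = v"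
    using gram_schmidt_hd[OF v(1), of "tl (basis_completion v)"] by argo
  then show ?thesis
    using gs b(6) unfolding corthogonal_def by metis
qed

text \<open>Every vector of an orthogonal completion is scaled to length one, so the first column is
  a multiple of \<open>v\<close> and not \<open>v\<close> itself.\<close>

lemma unitary_completion:
  assumes v: "(v :: 'a vec) \<in> carrier_vec n" "v \<noteq> 0\<^sub>v n"
  shows "\<exists>X Y c. X \<in> carrier_mat n 1 \<and> Y \<in> carrier_mat n (n - 1) \<and> col X 0 = c \<cdot>\<^sub>v v \<and>
    unitary_mat (append_cols_mat X Y)"
proof -
  obtain ws where ws: "set ws \<subseteq> carrier_vec n" "length ws = n" "hd ws = v"
    and ws_orth: "\<And>i j. i < n \<Longrightarrow> j < n \<Longrightarrow> ws ! i \<bullet>c ws ! j = 0 \<longleftrightarrow> i \<noteq> j"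
    using orthogonal_completion[OF v] by blast
  have "n \<noteq> 0"
    using v by auto
  have nz: "w \<in> carrier_vec n" "w \<noteq> 0\<^sub>v n" if mem: "w \<in> set ws" for w
  proof -
    show w: "w \<in> carrier_vec n" by (rule subsetD[OF ws(1) mem])
    obtain i where i: "i < length ws" "w = ws ! i"
      using mem unfolding in_set_conv_nth by blast
    then have "i < n"
      using ws(2) by simp
    then have "w \<bullet>c w \<noteq> 0"
      using ws_orth[of i i] unfolding i(2) by blast
    then show "w \<noteq> 0\<^sub>v n"
      by (rule contrapos_nn) (simp only: conjugate_zero_vec scalar_prod_left_zero zero_carrier_vec)
  qed
  \<comment> \<open>The scaling factor is chosen for each vector separately; its properties are
    available on \<open>ws\<close>, whose members are nonzero.\<close>
  define c where "c w = (SOME c. c \<noteq> 0 \<and> (c \<cdot>\<^sub>v w) \<bullet>c (c \<cdot>\<^sub>v w) = 1)" for w :: "'a vec"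
  have c: "c w \<noteq> 0" "(c w \<cdot>\<^sub>v w) \<bullet>c (c w \<cdot>\<^sub>v w) = 1" if "w \<in> set ws" for w
    using someI_ex[OF normalize_vec[OF nz[OF that]]] by (auto simp: c_def)
  define us where "us = map (\<lambda>w. c w \<cdot>\<^sub>v w) ws"
  have us: "set us \<subseteq> carrier_vec n" "length us = n"
    using ws by (auto simp: us_def)
  have orth: "us ! i \<bullet>c us ! j = (if i = j then 1 else 0)" if "i < n" "j < n" for i j
  proof (cases "i = j")
    case True
    then show ?thesis using c(2)[of "ws ! j"] that ws(2) by (simp add: us_def)
  next
    case False
    then have "ws ! i \<bullet>c ws ! j = 0"
      using ws_orth that by blast
    moreover have "ws ! i \<in> carrier_vec n" "ws ! j \<in> carrier_vec n"
      using that ws by auto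
    ultimately show ?thesis
      using False that ws(2) by (simp add: us_def conjugate_smult_vec)
  qed
  define U where "U = mat_of_cols n us"
  have U: "U \<in> carrier_mat n n"
    using us by (auto simp: U_def)
  have "U\<^sup>H * U = 1\<^sub>m n"
  proof (rule eq_matI)
    fix i j assume "i < dim_row (1\<^sub>m n)" "j < dim_col (1\<^sub>m n)"
    then have ij: "i < n" "j < n" by auto
    then have carr: "us ! i \<in> carrier_vec n" "us ! j \<in> carrier_vec n"
      using us by auto
    have "row (U\<^sup>H) i = conjugate (us ! i)"
      using ij U us carr by (intro eq_vecI) (auto simp: U_def mat_of_cols_index)
    moreover have "col U j = us ! j"
      using ij us carr by (simp add: U_def)
    ultimately have "(U\<^sup>H * U) $$ (i, j) = conjugate (us ! i) \<bullet> us ! j"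
      using ij U by simp
    also have "\<dots> = us ! j \<bullet>c us ! i"
      using carr conjugate_vec_sprod_comm by metis
    finally show "(U\<^sup>H * U) $$ (i, j) = 1\<^sub>m n $$ (i, j)"
      using orth ij by simp
  qed (use U in auto)
  then have "unitary_mat U"
    using U by (auto simp: unitary_mat_def orthonormal_cols_def)
  define X where "X = mat_of_cols n [hd us]"
  define Y where "Y = mat_of_cols n (tl us)"
  have "us \<noteq> []"
    using us \<open>n \<noteq> 0\<close> by auto
  then have cons: "us = hd us # tl us" by simp
  then have sub: "hd us \<in> carrier_vec n" "set (tl us) \<subseteq> carrier_vec n"
    using us(1) by (cases us; auto)+
  have "append_cols_mat X Y = U"
    using sub cons by (simp add: append_cols_mat_def X_def Y_def U_def)
  moreover have "col X 0 = c v \<cdot>\<^sub>v v"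
    using sub ws(3) \<open>us \<noteq> []\<close> by (simp add: X_def us_def hd_map)
  moreover have "X \<in> carrier_mat n 1" "Y \<in> carrier_mat n (n - 1)"
    using us by (auto simp: X_def Y_def)
  ultimately show ?thesis
    using \<open>unitary_mat U\<close> by blast
qed

end

subsection \<open>The spectral theorem\<close>

lemma adjoint_mult_swap_zero:
  assumes "V \<in> carrier_mat n p" "W \<in> carrier_mat n q" "V\<^sup>H * W = 0\<^sub>m p q"
  shows "W\<^sup>H * V = 0\<^sub>m q p"
  using mat_adjoint_mult[of "V\<^sup>H" p n W q] assms by simp

lemma hermitian_sandwich:
  assumes "A \<in> carrier_mat n n" "hermitian_mat A" "Y \<in> carrier_mat n m"
  shows "hermitian_mat (Y\<^sup>H * A * Y)"
proof -
  have "(Y\<^sup>H * A * Y)\<^sup>H = Y\<^sup>H * (Y\<^sup>H * A)\<^sup>H"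
    using assms by (intro mat_adjoint_mult[of _ m n _ m]) auto
  also have "(Y\<^sup>H * A)\<^sup>H = A * Y"
    using assms by (subst mat_adjoint_mult[of _ m n _ n]) (auto simp: hermitian_mat_def)
  also have "Y\<^sup>H * (A * Y) = Y\<^sup>H * A * Y"
    using assms by (intro assoc_mult_mat[symmetric, of _ m n _ n _ m]) auto
  finally show ?thesis
    by (simp add: hermitian_mat_def)
qed

lemma sandwich_mult:
  assumes "Y \<in> carrier_mat n m" "W \<in> carrier_mat m p" "T \<in> carrier_mat p p"
  shows "(Y * W) * T * (Y * W)\<^sup>H = Y * (W * T * W\<^sup>H) * Y\<^sup>H"
proof -
  have "(Y * W)\<^sup>H = W\<^sup>H * Y\<^sup>H"
    by (rule mat_adjoint_mult[OF assms(1,2)])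
  then show ?thesis
    using assms
    by (simp add: assoc_mult_mat[of _ n m _ p _ p] assoc_mult_mat[of _ n m _ p _ m]
        assoc_mult_mat[of _ n m _ m _ n] assoc_mult_mat[of _ m p _ p _ m]
        assoc_mult_mat[of _ m p _ m _ n] assoc_mult_mat[of _ m p _ p _ n]
        assoc_mult_mat[of _ p p _ m _ n] assoc_mult_mat[of _ n p _ m _ n]
        assoc_mult_mat[of _ n m _ p _ n] assoc_mult_mat[of _ n p _ p _ n]
        mult_carrier_mat[of _ _ m] mult_carrier_mat[of _ _ p])
qed

lemma sandwich_add:
  assumes Y: "Y \<in> carrier_mat n m" and AB: "A \<in> carrier_mat m m" "B \<in> carrier_mat m m"
  shows "Y * (A + B) * Y\<^sup>H = Y * A * Y\<^sup>H + Y * B * Y\<^sup>H"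
proof -
  have "Y * (A + B) = Y * A + Y * B"
    using Y AB by (rule mult_add_distrib_mat)
  then show ?thesis
    using Y AB add_mult_distrib_mat[of "Y * A" n m "Y * B" "Y\<^sup>H" n] by simp
qed

text \<open>\<open>Y\<close> is an isometry: \<open>Y\<^sup>H * Y\<close> cancels in the middle.
  Lifting the eigenvectors of a compression by \<open>Y\<close> therefore keeps them
  orthonormal.\<close>

lemma gram_mult_orthonormal:
  assumes Y: "Y \<in> carrier_mat n m" and YY: "Y\<^sup>H * Y = 1\<^sub>m m"
    and BC: "B \<in> carrier_mat m p" "C \<in> carrier_mat m q"
  shows "(Y * B)\<^sup>H * (Y * C) = B\<^sup>H * C"
proof -
  have "(Y * B)\<^sup>H * (Y * C) = B\<^sup>H * Y\<^sup>H * (Y * C)"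
    using mat_adjoint_mult[OF Y BC(1)] by simp
  also have "\<dots> = B\<^sup>H * (Y\<^sup>H * (Y * C))"
    using BC Y by (intro assoc_mult_mat[of _ p m _ n _ q]) auto
  also have "Y\<^sup>H * (Y * C) = Y\<^sup>H * Y * C"
    using BC Y by (intro assoc_mult_mat[symmetric, of _ m n _ m _ q]) auto
  finally show ?thesis
    using YY BC by simp
qed

text \<open>Deflation: the line spanned by \<open>X\<close> is invariant under \<open>A\<close>, and
  Hermitian symmetry makes its orthogonal complement, spanned by the columns of \<open>Y\<close>,
  invariant as well. In this basis \<open>A\<close> is block diagonal.\<close>

lemma hermitian_split_eigenvector:
  fixes A :: "'a :: conjugatable_field mat"
  assumes A: "A \<in> carrier_mat n n" and herm: "hermitian_mat A"
    and X: "X \<in> carrier_mat n 1" and Y: "Y \<in> carrier_mat n m"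
    and unit: "unitary_mat (append_cols_mat X Y)" and AX: "A * X = e \<cdot>\<^sub>m X"
  shows "A = X * (e \<cdot>\<^sub>m 1\<^sub>m 1) * X\<^sup>H + Y * (Y\<^sup>H * A * Y) * Y\<^sup>H"
proof -
  note u = unit[unfolded unitary_append_cols_iff[OF X Y]]
  have YX: "Y\<^sup>H * X = 0\<^sub>m m 1"
    using adjoint_mult_swap_zero[OF X Y] u by blast
  have c: "A * Y \<in> carrier_mat n m" "X\<^sup>H * (A * Y) \<in> carrier_mat 1 m"
    "Y\<^sup>H * (A * Y) \<in> carrier_mat m m"
    using A X Y by auto
  \<comment> \<open>The off-diagonal block is treated through its adjoint, where \<open>A\<close>
    stands next to \<open>X\<close> and the eigenvector equation applies.\<close>
  have "(X\<^sup>H * (A * Y))\<^sup>H = (A * Y)\<^sup>H * X"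
    using mat_adjoint_mult[of "X\<^sup>H" 1 n "A * Y" m] X c by simp
  also have "(A * Y)\<^sup>H = Y\<^sup>H * A"
    using mat_adjoint_mult[OF A Y] herm by (simp add: hermitian_mat_def)
  also have "Y\<^sup>H * A * X = Y\<^sup>H * (e \<cdot>\<^sub>m X)"
    using assoc_mult_mat[of "Y\<^sup>H" m n A n X 1] A X Y AX by simp
  also have "\<dots> = 0\<^sub>m m 1"
    using mult_smult_distrib[of "Y\<^sup>H" m n X 1 e] X Y YX by simp
  finally have XAY: "X\<^sup>H * (A * Y) = 0\<^sub>m 1 m"
    by (metis mat_adjoint_adjoint mat_adjoint_zero)
  \<comment> \<open>Inserting the resolution of the identity on the left leaves only the
    \<open>Y\<close> component, so \<open>A\<close> maps the span of the columns of \<open>Y\<close>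
    into itself.\<close>
  have "A * Y = (X * X\<^sup>H + Y * Y\<^sup>H) * (A * Y)"
    using unitary_append_cols_resolution[OF X Y unit] left_mult_one_mat[OF c(1)] by simp
  also have "\<dots> = X * X\<^sup>H * (A * Y) + Y * Y\<^sup>H * (A * Y)"
    using X Y c by (intro add_mult_distrib_mat[of _ n n _ _ m]) auto
  also have "X * X\<^sup>H * (A * Y) = X * (X\<^sup>H * (A * Y))"
    using X c by (intro assoc_mult_mat[of _ n 1 _ n _ m]) auto
  also have "Y * Y\<^sup>H * (A * Y) = Y * (Y\<^sup>H * (A * Y))"
    using Y c by (intro assoc_mult_mat[of _ n m _ n _ m]) auto
  finally have AY: "A * Y = Y * (Y\<^sup>H * (A * Y))"
    using X Y c unfolding XAY by simp
  have "A = A * (X * X\<^sup>H + Y * Y\<^sup>H)"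
    using unitary_append_cols_resolution[OF X Y unit] right_mult_one_mat[OF A] by simp
  also have "\<dots> = A * (X * X\<^sup>H) + A * (Y * Y\<^sup>H)"
    using A X Y by (intro mult_add_distrib_mat[of _ n n]) auto
  also have "A * (X * X\<^sup>H) = A * X * X\<^sup>H"
    using A X by (intro assoc_mult_mat[symmetric, of _ n n _ 1 _ n]) auto
  also have "A * X = X * (e \<cdot>\<^sub>m 1\<^sub>m 1)"
    using mult_smult_distrib[of X n 1 "1\<^sub>m 1" 1 e] X AX by simp
  also have "A * (Y * Y\<^sup>H) = A * Y * Y\<^sup>H"
    using A Y by (intro assoc_mult_mat[symmetric, of _ n n _ m _ n]) auto
  also have "A * Y = Y * (Y\<^sup>H * A * Y)"
    using AY assoc_mult_mat[of "Y\<^sup>H" m n A n Y m] A Y by simp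
  finally show ?thesis .
qed

text \<open>\<open>Wp\<close> stands for either sign group of the compression and \<open>Wm\<close>
  for the other: no sign is assumed, so both cases of the induction are served by exchanging the
  groups. The lifted eigenvectors \<open>Y * Wp\<close> receive \<open>X\<close> as new first column
  and \<open>e\<close> as new first diagonal entry.\<close>

lemma extend_eigenblock:
  fixes X Y Wp Wm Tp :: "'a :: conjugatable_ordered_field mat" and e :: 'a
  assumes X: "X \<in> carrier_mat n 1" and Y: "Y \<in> carrier_mat n m"
    and unit: "unitary_mat (append_cols_mat X Y)"
    and Wp: "Wp \<in> carrier_mat m p" and Wm: "Wm \<in> carrier_mat m q"
    and Tp: "Tp \<in> carrier_mat p p" "diagonal_mat Tp"
    and Wp_orth: "Wp\<^sup>H * Wp = 1\<^sub>m p" and Wpm: "Wp\<^sup>H * Wm = 0\<^sub>m p q"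
  defines "V \<equiv> append_cols_mat X (Y * Wp)"
    and "T \<equiv> four_block_mat (e \<cdot>\<^sub>m 1\<^sub>m 1) (0\<^sub>m 1 p) (0\<^sub>m p 1) Tp"
  shows "V \<in> carrier_mat n (1 + p)" "T \<in> carrier_mat (1 + p) (1 + p)" "diagonal_mat T"
    and "V\<^sup>H * V = 1\<^sub>m (1 + p)" "V\<^sup>H * (Y * Wm) = 0\<^sub>m (1 + p) q"
    and "V * T * V\<^sup>H = X * (e \<cdot>\<^sub>m 1\<^sub>m 1) * X\<^sup>H + Y * (Wp * Tp * Wp\<^sup>H) * Y\<^sup>H"
    and "\<And>i. i < 1 + p \<Longrightarrow> T $$ (i, i) = (if i = 0 then e else Tp $$ (i - 1, i - 1))"
proof -
  have YW: "Y * Wp \<in> carrier_mat n p" "Y * Wm \<in> carrier_mat n q"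
    using Y Wp Wm by auto
  have XX: "X\<^sup>H * X = 1\<^sub>m 1" and YY: "Y\<^sup>H * Y = 1\<^sub>m m"
    using unit unitary_append_cols_iff[OF X Y] by blast+
  have eigvec_mult: "X\<^sup>H * (Y * B) = 0\<^sub>m 1 d" if "B \<in> carrier_mat m d" for B d
  proof -
    have "X\<^sup>H * (Y * B) = X\<^sup>H * Y * B"
      using that X Y by (intro assoc_mult_mat[symmetric, of _ 1 n _ m _ d]) auto
    then show ?thesis
      using unit unitary_append_cols_iff[OF X Y] that by simp
  qed
  show "V \<in> carrier_mat n (1 + p)"
    unfolding V_def by (rule append_cols_mat_carrier[OF X YW(1)])
  show "T \<in> carrier_mat (1 + p) (1 + p)"
    unfolding T_def by (rule four_block_carrier_mat) (use Tp in auto)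
  show "diagonal_mat T"
    using Tp by (auto simp: T_def diagonal_mat_def)
  have "V\<^sup>H * V = four_block_mat (1\<^sub>m 1) (0\<^sub>m 1 p) (0\<^sub>m p 1) (1\<^sub>m p)"
    unfolding V_def append_cols_gram[OF X YW(1)] XX gram_mult_orthonormal[OF Y YY Wp Wp] Wp_orth eigvec_mult[OF Wp]
      adjoint_mult_swap_zero[OF X YW(1) eigvec_mult[OF Wp]] ..
  then show "V\<^sup>H * V = 1\<^sub>m (1 + p)"
    by (simp only: four_block_one_mat)
  show "V\<^sup>H * (Y * Wm) = 0\<^sub>m (1 + p) q"
    unfolding V_def using X YW gram_mult_orthonormal[OF Y YY Wp Wm] eigvec_mult[OF Wm] Wpm
    by (intro append_cols_adjoint_mult_zero) auto
  show "V * T * V\<^sup>H = X * (e \<cdot>\<^sub>m 1\<^sub>m 1) * X\<^sup>H + Y * (Wp * Tp * Wp\<^sup>H) * Y\<^sup>H"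
    using append_cols_sandwich[OF X YW(1) _ Tp(1), of "e \<cdot>\<^sub>m 1\<^sub>m 1"] sandwich_mult[OF Y Wp Tp(1)]
    by (simp add: V_def T_def)
  show "T $$ (i, i) = (if i = 0 then e else Tp $$ (i - 1, i - 1))" if "i < 1 + p" for i
    using that Tp by (auto simp: T_def)
qed

text \<open>Trades unitarity of the concatenation for a dimension count and three Gram equations,
  with the group sizes \<open>p\<close> and \<open>q\<close> made explicit.\<close>

lemma signed_eigendecompI:
  assumes "M \<in> carrier_mat n n" "Wp \<in> carrier_mat n p" "Wm \<in> carrier_mat n q" "p + q = n"
    and "Wp\<^sup>H * Wp = 1\<^sub>m p" "Wm\<^sup>H * Wm = 1\<^sub>m q" "Wp\<^sup>H * Wm = 0\<^sub>m p q"
    and "Tp \<in> carrier_mat p p" "diagonal_mat Tp" "\<And>i. i < p \<Longrightarrow> 0 < Tp $$ (i, i)"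
    and "Tm \<in> carrier_mat q q" "diagonal_mat Tm" "\<And>i. i < q \<Longrightarrow> Tm $$ (i, i) \<le> 0"
    and "M = Wp * Tp * Wp\<^sup>H + Wm * Tm * Wm\<^sup>H"
  shows "signed_eigendecomp M Wp Tp Wm Tm"
  using assms unitary_append_cols_iff[OF assms(2,3)] carrier_matD[OF assms(1)]
    carrier_matD[OF assms(2)] carrier_matD[OF assms(3)]
  unfolding signed_eigendecomp_def by simp

lemma signed_eigendecompD:
  assumes M: "M \<in> carrier_mat n n" and sd: "signed_eigendecomp M Wp Tp Wm Tm"
  obtains p q where "Wp \<in> carrier_mat n p" "Wm \<in> carrier_mat n q" "p + q = n"
    and "Wp\<^sup>H * Wp = 1\<^sub>m p" "Wm\<^sup>H * Wm = 1\<^sub>m q" "Wp\<^sup>H * Wm = 0\<^sub>m p q"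
    and "Tp \<in> carrier_mat p p" "diagonal_mat Tp" "\<And>i. i < p \<Longrightarrow> 0 < Tp $$ (i, i)"
    and "Tm \<in> carrier_mat q q" "diagonal_mat Tm" "\<And>i. i < q \<Longrightarrow> Tm $$ (i, i) \<le> 0"
    and "M = Wp * Tp * Wp\<^sup>H + Wm * Tm * Wm\<^sup>H"
proof -
  have c: "Wp \<in> carrier_mat n (dim_col Wp)" "Wm \<in> carrier_mat n (dim_col Wm)"
    using sd carrier_matD(1)[OF M] unfolding signed_eigendecomp_def by metis+
  show ?thesis
    using that[OF c] sd unitary_append_cols_iff[OF c] unfolding signed_eigendecomp_def by blast
qed

context inner_field
begin

text \<open>Induction on the dimension: a unit eigenvector is split off, the compression to its
  orthogonal complement is decomposed by the induction hypothesis, and the new eigenvalue joins the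
  group that fits its sign.\<close>

theorem hermitian_signed_eigendecomp:
  assumes "(A :: 'a mat) \<in> carrier_mat n n" "hermitian_mat A"
  shows "\<exists>Wp Tp Wm Tm. signed_eigendecomp A Wp Tp Wm Tm"
  using assms
proof (induction n arbitrary: A)
  case 0
  then have "signed_eigendecomp A (0\<^sub>m 0 0) (0\<^sub>m 0 0) (0\<^sub>m 0 0) (0\<^sub>m 0 0)"
    by (intro signed_eigendecompI[of _ 0 _ 0 _ 0]) (auto simp: diagonal_mat_def)
  then show ?case by blast
next
  case (Suc m)
  define n where "n = Suc m"
  have A: "A \<in> carrier_mat n n"
    using Suc.prems(1) unfolding n_def .
  obtain e v where ev: "eigenvector A v e"
    using hermitian_eigenvalue[OF Suc.prems] unfolding eigenvalue_def by blast
  have v: "v \<in> carrier_vec n" "v \<noteq> 0\<^sub>v n" "A *\<^sub>v v = e \<cdot>\<^sub>v v"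
    using ev A unfolding eigenvector_def by auto
  \<comment> \<open>The order on \<open>'a\<close> may be partial; writing \<open>e\<close> as a
    real number makes the later distinction on its sign exhaustive.\<close>
  obtain r where r: "e = of_real r"
    using conjugate_fixed_imp_real hermitian_eigenvalue_conjugate[OF Suc.prems ev] by blast
  obtain X Y c where X: "X \<in> carrier_mat n 1" and Y: "Y \<in> carrier_mat n m"
    and col: "col X 0 = c \<cdot>\<^sub>v v" and unit: "unitary_mat (append_cols_mat X Y)"
    using unitary_completion[OF v(1,2)] unfolding n_def diff_Suc_1 by blast
  have "A *\<^sub>v (c \<cdot>\<^sub>v v) = c \<cdot>\<^sub>v (A *\<^sub>v v)"
    using A v(1) by (rule mult_mat_vec)
  then have "A *\<^sub>v col X 0 = e \<cdot>\<^sub>v col X 0"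
    by (simp add: col v(3) smult_smult_assoc mult.commute)
  then have AX: "A * X = e \<cdot>\<^sub>m X"
    by (rule mult_col_scaled[OF A X])
  note split = hermitian_split_eigenvector[OF A Suc.prems(2) X Y unit AX]
  have A': "Y\<^sup>H * A * Y \<in> carrier_mat m m"
    using A Y by auto
  obtain Wp Tp Wm Tm where sd: "signed_eigendecomp (Y\<^sup>H * A * Y) Wp Tp Wm Tm"
    using Suc.IH[OF A' hermitian_sandwich[OF A Suc.prems(2) Y]] by blast
  from A' sd obtain p q where W: "Wp \<in> carrier_mat m p" "Wm \<in> carrier_mat m q" "p + q = m"
    and orth: "Wp\<^sup>H * Wp = 1\<^sub>m p" "Wm\<^sup>H * Wm = 1\<^sub>m q" "Wp\<^sup>H * Wm = 0\<^sub>m p q"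
    and Tp: "Tp \<in> carrier_mat p p" "diagonal_mat Tp" "\<And>i. i < p \<Longrightarrow> 0 < Tp $$ (i, i)"
    and Tm: "Tm \<in> carrier_mat q q" "diagonal_mat Tm" "\<And>i. i < q \<Longrightarrow> Tm $$ (i, i) \<le> 0"
    and eq: "Y\<^sup>H * A * Y = Wp * Tp * Wp\<^sup>H + Wm * Tm * Wm\<^sup>H"
    by (rule signed_eigendecompD) blast
  have orth': "Wm\<^sup>H * Wp = 0\<^sub>m q p"
    by (rule adjoint_mult_swap_zero[OF W(1,2) orth(3)])
  define E where "E = X * (e \<cdot>\<^sub>m 1\<^sub>m 1) * X\<^sup>H"
  define P where "P = Y * (Wp * Tp * Wp\<^sup>H) * Y\<^sup>H"
  define N where "N = Y * (Wm * Tm * Wm\<^sup>H) * Y\<^sup>H"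
  have EPN: "E \<in> carrier_mat n n" "P \<in> carrier_mat n n" "N \<in> carrier_mat n n"
    using X Y W Tp(1) Tm(1) by (auto simp: E_def P_def N_def)
  have WT: "Wp * Tp * Wp\<^sup>H \<in> carrier_mat m m" "Wm * Tm * Wm\<^sup>H \<in> carrier_mat m m"
    using W Tp(1) Tm(1) by auto
  have sum: "A = E + (P + N)"
    using split unfolding eq E_def P_def N_def sandwich_add[OF Y WT] .
  have YW: "Y * Wp \<in> carrier_mat n p" "Y * Wm \<in> carrier_mat n q"
    using Y W by auto
  have YY: "Y\<^sup>H * Y = 1\<^sub>m m"
    using unit unitary_append_cols_iff[OF X Y] by blast
  note Ygram = gram_mult_orthonormal[OF Y YY W(1) W(1), unfolded orth(1)]
    gram_mult_orthonormal[OF Y YY W(2) W(2), unfolded orth(2)]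
  show ?case
  proof (cases "0 < r")
    case True
    then have "0 < e"
      using of_real_le_of_real[of 0 r] by (simp add: r less_le)
    note ext = extend_eigenblock[OF X Y unit W(1,2) Tp(1,2) orth(1,3)]
    have "A = (E + P) + N"
      using sum EPN by simp
    then have "signed_eigendecomp A (append_cols_mat X (Y * Wp))
      (four_block_mat (e \<cdot>\<^sub>m 1\<^sub>m 1) (0\<^sub>m 1 p) (0\<^sub>m p 1) Tp) (Y * Wm) Tm"
      by (intro signed_eigendecompI[OF A ext(1) YW(2) _ ext(4) Ygram(2) ext(5) ext(2)
            ext(3) _ Tm])
        (use W(3) ext(6,7) Tp(3) \<open>0 < e\<close> sandwich_mult[OF Y W(2) Tm(1)] in
          \<open>simp_all add: n_def E_def P_def N_def\<close>)
    then show ?thesis by blast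
  next
    \<comment> \<open>A zero eigenvalue falls under this case and joins the non-positive group;
      \<open>extend_eigenblock\<close> is applied with the two groups exchanged.\<close>
    case False
    then have "e \<le> 0"
      using of_real_le_of_real[of r 0] by (simp add: r)
    note ext = extend_eigenblock[OF X Y unit W(2,1) Tm(1,2) orth(2) orth']
    have "A = P + (E + N)"
      using sum EPN assoc_add_mat[of E n n P N] assoc_add_mat[of P n n E N] comm_add_mat[of E n n P]
      by simp
    then have "signed_eigendecomp A (Y * Wp) Tp (append_cols_mat X (Y * Wm))
      (four_block_mat (e \<cdot>\<^sub>m 1\<^sub>m 1) (0\<^sub>m 1 q) (0\<^sub>m q 1) Tm)"
      by (intro signed_eigendecompI[OF A YW(1) ext(1) _ Ygram(1) ext(4)
            adjoint_mult_swap_zero[OF ext(1) YW(1) ext(5)] Tp ext(2,3)])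
        (use W(3) ext(6,7) Tm(3) \<open>e \<le> 0\<close> sandwich_mult[OF Y W(1) Tp(1)] in
          \<open>simp_all add: n_def E_def P_def N_def\<close>)
    then show ?thesis by blast
  qed
qed

text \<open>By the spectral theorem the choice in \<open>psd_proj\<close> has a candidate, so its
  value is the positive part of some decomposition.\<close>

lemma psd_proj_eigendecomp:
  assumes "(M :: 'a mat) \<in> carrier_mat n n" "hermitian_mat M"
  obtains Wp Tp Wm Tm where "signed_eigendecomp M Wp Tp Wm Tm" "psd_proj M = Wp * Tp * Wp\<^sup>H"
proof -
  have "\<exists>P Wp Tp Wm Tm. signed_eigendecomp M Wp Tp Wm Tm \<and> P = Wp * Tp * Wp\<^sup>H"
    using hermitian_signed_eigendecomp[OF assms] by blast
  from someI_ex[OF this] that show ?thesis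
    unfolding psd_proj_def by blast
qed

end

subsection \<open>Traces, positive semidefinite matrices and the Frobenius norm\<close>

definition mat_trace :: "'a :: comm_monoid_add mat \<Rightarrow> 'a" where
  "mat_trace M = (\<Sum>i<dim_row M. M $$ (i, i))"

lemma mat_trace_add:
  "\<lbrakk>A \<in> carrier_mat n n; B \<in> carrier_mat n n\<rbrakk> \<Longrightarrow> mat_trace (A + B) = mat_trace A + mat_trace B"
  by (simp add: mat_trace_def sum.distrib)

lemma mat_trace_minus:
  "\<lbrakk>A \<in> carrier_mat n n; B \<in> carrier_mat n n\<rbrakk>
    \<Longrightarrow> mat_trace (A - B) = mat_trace A - (mat_trace B :: 'a :: ab_group_add)"
  by (simp add: mat_trace_def sum_subtractf)

lemma mat_trace_mult:
  assumes "A \<in> carrier_mat r c" "B \<in> carrier_mat c r"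
  shows "mat_trace (A * B) = (\<Sum>i<r. \<Sum>j<c. A $$ (i, j) * B $$ (j, i))"
  using assms by (simp add: mat_trace_def scalar_prod_def lessThan_atLeast0)

lemma mat_trace_comm:
  fixes A B :: "'a :: comm_semiring_0 mat"
  assumes "A \<in> carrier_mat r c" "B \<in> carrier_mat c r"
  shows "mat_trace (A * B) = mat_trace (B * A)"
proof -
  have "(\<Sum>i<r. \<Sum>j<c. A $$ (i, j) * B $$ (j, i)) = (\<Sum>j<c. \<Sum>i<r. A $$ (i, j) * B $$ (j, i))"
    by (rule sum.swap)
  then show ?thesis
    unfolding mat_trace_mult[OF assms] mat_trace_mult[OF assms(2,1)] by (simp only: mult.commute)
qed

lemma frobenius_norm_nonneg: "0 \<le> frobenius_norm M"
  by (simp add: frobenius_norm_def sum_nonneg)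

text \<open>The Frobenius norm is the \<open>L2_set\<close> norm over index pairs, so Minkowski's
  inequality applies after the entrywise triangle inequality.\<close>

lemma frobenius_norm_triangle:
  assumes "A \<in> carrier_mat r c" "B \<in> carrier_mat r c"
  shows "frobenius_norm (A + B) \<le> frobenius_norm A + frobenius_norm B"
proof -
  have eq: "frobenius_norm M = L2_set (\<lambda>ij. norm (M $$ ij)) ({..<r} \<times> {..<c})"
    if "M \<in> carrier_mat r c" for M :: "'a mat"
    using that by (simp add: frobenius_norm_def L2_set_def sum.cartesian_product)
  have "frobenius_norm (A + B) \<le> L2_set (\<lambda>ij. norm (A $$ ij) + norm (B $$ ij)) ({..<r} \<times> {..<c})"
    unfolding eq[OF add_carrier_mat[OF assms(2)]]
    using assms by (intro L2_set_mono) (auto simp: norm_triangle_ineq)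
  also have "\<dots> \<le> frobenius_norm A + frobenius_norm B"
    unfolding eq[OF assms(1)] eq[OF assms(2)] by (rule L2_set_triangle_ineq)
  finally show ?thesis .
qed

section \<open>Closure properties of the positive semidefinite cone and nonnegative traces\<close>

lemma psd_mat_add:
  fixes A :: "'a :: conjugatable_ordered_field mat"
  assumes "A \<in> carrier_mat n n" "B \<in> carrier_mat n n" "psd_mat A" "psd_mat B"
  shows "psd_mat (A + B)"
  unfolding psd_mat_def
proof (intro conjI ballI)
  show "hermitian_mat (A + B)"
    using assms mat_adjoint_add[OF assms(1,2)] by (simp add: psd_mat_def hermitian_mat_def)
  fix v :: "'a vec" assume "v \<in> carrier_vec (dim_row (A + B))"
  then have v: "v \<in> carrier_vec n"
    using assms by simp
  have "((A + B) *\<^sub>v v) \<bullet>c v = (A *\<^sub>v v) \<bullet>c v + (B *\<^sub>v v) \<bullet>c v"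
    unfolding add_mult_distrib_mat_vec[OF assms(1,2) v]
    using assms v by (intro add_scalar_prod_distrib[of _ n]) auto
  moreover have "0 \<le> (A *\<^sub>v v) \<bullet>c v" "0 \<le> (B *\<^sub>v v) \<bullet>c v"
    using assms v unfolding psd_mat_def by auto
  ultimately show "0 \<le> ((A + B) *\<^sub>v v) \<bullet>c v"
    by (simp add: add_nonneg_nonneg)
qed

text \<open>The form of \<open>W\<^sup>H * M * W\<close> at \<open>v\<close> is the form of
  \<open>M\<close> at \<open>W *\<^sub>v v\<close>.\<close>

lemma psd_mat_sandwich:
  fixes M :: "'a :: conjugatable_ordered_field mat"
  assumes M: "M \<in> carrier_mat n n" "psd_mat M" and W: "W \<in> carrier_mat n m"
  shows "psd_mat (W\<^sup>H * M * W)"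
  unfolding psd_mat_def
proof (intro conjI ballI)
  show "hermitian_mat (W\<^sup>H * M * W)"
    using assms by (intro hermitian_sandwich) (auto simp: psd_mat_def)
  fix v :: "'a vec" assume "v \<in> carrier_vec (dim_row (W\<^sup>H * M * W))"
  then have v: "v \<in> carrier_vec m"
    using W by simp
  have Wv: "W *\<^sub>v v \<in> carrier_vec n"
    using W v by simp
  have "(W\<^sup>H * M * W) *\<^sub>v v = (W\<^sup>H * M) *\<^sub>v (W *\<^sub>v v)"
    using W M v by (intro assoc_mult_mat_vec[of _ m n _ m]) auto
  also have "\<dots> = W\<^sup>H *\<^sub>v (M *\<^sub>v (W *\<^sub>v v))"
    using W M Wv by (intro assoc_mult_mat_vec[of _ m n _ n]) auto
  finally have "((W\<^sup>H * M * W) *\<^sub>v v) \<bullet>c v = (M *\<^sub>v (W *\<^sub>v v)) \<bullet>c (W *\<^sub>v v)"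
    using adjoint_mult_vec_cscalar[OF W _ v] M(1) Wv by simp
  then show "0 \<le> ((W\<^sup>H * M * W) *\<^sub>v v) \<bullet>c v"
    using M Wv unfolding psd_mat_def by auto
qed

lemma psd_mat_sandwich':
  assumes "M \<in> carrier_mat n n" "psd_mat M" "W \<in> carrier_mat m n"
  shows "psd_mat (W * M * W\<^sup>H)"
  using psd_mat_sandwich[OF assms(1,2), of "W\<^sup>H" m] assms(3) by simp

context inner_field
begin

text \<open>Nonnegative elements are images of nonnegative reals, from which the claim is
  inherited.\<close>

lemma mult_nonneg: "\<lbrakk>0 \<le> (a :: 'a); 0 \<le> b\<rbrakk> \<Longrightarrow> 0 \<le> a * b"
proof -
  assume "0 \<le> a" "0 \<le> b"
  then obtain r s where "a = of_real r" "b = of_real s" "0 \<le> r" "0 \<le> s"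
    using nonneg_imp_real by metis
  then show ?thesis
    using of_real_le_of_real[of 0 "r * s"] by simp
qed

lemma conjugate_one: "conjugate 1 = (1 :: 'a)"
  using conjugate_of_real[of 1] by simp

lemma psd_mat_diag_nonneg:
  assumes "(M :: 'a mat) \<in> carrier_mat n n" "psd_mat M" "i < n"
  shows "0 \<le> M $$ (i, i)"
proof -
  have "conjugate (unit_vec n i) = (unit_vec n i :: 'a vec)"
    by (rule eq_vecI) (simp_all add: unit_vec_def conjugate_one)
  then have "(M *\<^sub>v unit_vec n i) \<bullet>c unit_vec n i = M $$ (i, i)"
    using assms by (simp add: scalar_prod_right_unit)
  moreover have "0 \<le> (M *\<^sub>v unit_vec n i) \<bullet>c unit_vec n i"
    using assms unfolding psd_mat_def by auto
  ultimately show ?thesis by simp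
qed

text \<open>The form at \<open>v\<close> sums the squared moduli of the entries of \<open>v\<close>,
  weighted by the diagonal of \<open>T\<close>; nonnegative diagonal entries are fixed by
  conjugation, which gives Hermitian symmetry.\<close>

lemma psd_diagonal_mat:
  assumes T: "(T :: 'a mat) \<in> carrier_mat n n" "diagonal_mat T" "\<And>i. i < n \<Longrightarrow> 0 \<le> T $$ (i, i)"
  shows "psd_mat T"
  unfolding psd_mat_def
proof (intro conjI ballI)
  show "hermitian_mat T"
    unfolding hermitian_mat_def
  proof (rule eq_matI)
    fix i j assume "i < dim_row T" "j < dim_col T"
    then have ij: "i < n" "j < n"
      using T(1) by auto
    show "T\<^sup>H $$ (i, j) = T $$ (i, j)"
    proof (cases "i = j")
      case True
      then show ?thesis
        using T(1) ij nonneg_imp_conjugate[OF T(3)[OF ij(1)]] by simp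
    next
      case False
      then show ?thesis
        using T(1,2) ij by (simp add: diagonal_mat_def)
    qed
  qed (use T in auto)
  fix v :: "'a vec" assume "v \<in> carrier_vec (dim_row T)"
  then have v: "v \<in> carrier_vec n"
    using T(1) by simp
  have Tv: "(T *\<^sub>v v) $ i = T $$ (i, i) * v $ i" if "i < n" for i
  proof -
    have "(T *\<^sub>v v) $ i = (\<Sum>j<n. T $$ (i, j) * v $ j)"
      using T(1) v that by (simp add: scalar_prod_def lessThan_atLeast0)
    also have "\<dots> = (\<Sum>j<n. if j = i then T $$ (i, i) * v $ i else 0)"
      using T(1,2) that by (intro sum.cong) (auto simp: diagonal_mat_def)
    finally show ?thesis
      using that by simp
  qed
  have "(T *\<^sub>v v) \<bullet>c v = (\<Sum>i<n. (T *\<^sub>v v) $ i * conjugate (v $ i))"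
    using v by (simp add: scalar_prod_def lessThan_atLeast0)
  also have "\<dots> = (\<Sum>i<n. T $$ (i, i) * (v $ i * conjugate (v $ i)))"
    by (intro sum.cong) (simp_all add: Tv mult.assoc)
  finally show "0 \<le> (T *\<^sub>v v) \<bullet>c v"
    using T(3) mult_nonneg conjugate_square_positive by (auto intro!: sum_nonneg)
qed

lemma mat_trace_psd_mult_nonneg:
  assumes T: "(T :: 'a mat) \<in> carrier_mat p p" "diagonal_mat T" "\<And>i. i < p \<Longrightarrow> 0 \<le> T $$ (i, i)"
    and W: "W \<in> carrier_mat n p" and M: "M \<in> carrier_mat n n" "psd_mat M"
  shows "0 \<le> mat_trace (W * T * W\<^sup>H * M)"
proof -
  have S: "W\<^sup>H * M * W \<in> carrier_mat p p" "psd_mat (W\<^sup>H * M * W)"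
    using W M psd_mat_sandwich[OF M W] by auto
  have "W * T * W\<^sup>H * M = W * T * (W\<^sup>H * M)"
    using W T M by (intro assoc_mult_mat[of _ n p _ n _ n]) auto
  also have "\<dots> = W * (T * (W\<^sup>H * M))"
    using W T M by (intro assoc_mult_mat[of _ n p _ p _ n]) auto
  finally have "mat_trace (W * T * W\<^sup>H * M) = mat_trace (T * (W\<^sup>H * M) * W)"
    using W T(1) M(1) by (simp only:, intro mat_trace_comm[of _ n p]) auto
  also have "T * (W\<^sup>H * M) * W = T * (W\<^sup>H * M * W)"
    using W T M by (intro assoc_mult_mat[of _ p p _ n _ p]) auto
  also have "mat_trace \<dots> = (\<Sum>i<p. \<Sum>j<p. T $$ (i, j) * (W\<^sup>H * M * W) $$ (j, i))"
    by (rule mat_trace_mult[OF T(1) S(1)])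
  also have "\<dots> = (\<Sum>i<p. \<Sum>j<p. if j = i then T $$ (i, i) * (W\<^sup>H * M * W) $$ (i, i) else 0)"
    using T(1,2) by (intro sum.cong) (auto simp: diagonal_mat_def)
  also have "\<dots> = (\<Sum>i<p. T $$ (i, i) * (W\<^sup>H * M * W) $$ (i, i))"
    by (intro sum.cong) simp_all
  finally show ?thesis
    using T(3) psd_mat_diag_nonneg[OF S] mult_nonneg by (auto intro!: sum_nonneg)
qed

section \<open>The Frobenius norm expressed through traces\<close>

lemma frobenius_norm_eq_trace:
  assumes "(M :: 'a mat) \<in> carrier_mat r c"
  shows "of_real ((frobenius_norm M)\<^sup>2) = mat_trace (M * M\<^sup>H)"
proof -
  have "mat_trace (M * M\<^sup>H) = (\<Sum>i<r. \<Sum>j<c. M $$ (i, j) * M\<^sup>H $$ (j, i))"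
    using assms by (intro mat_trace_mult) auto
  also have "\<dots> = (\<Sum>i<r. \<Sum>j<c. of_real ((norm (M $$ (i, j)))\<^sup>2))"
    using assms by (intro sum.cong) (auto simp: mult_conjugate_eq_norm simp del: of_real_power)
  also have "\<dots> = of_real ((frobenius_norm M)\<^sup>2)"
    using assms by (simp add: frobenius_norm_def sum_nonneg)
  finally show ?thesis by simp
qed

lemma frobenius_norm_eqI:
  assumes "(M :: 'a mat) \<in> carrier_mat r c" "M' \<in> carrier_mat r' c'"
    and "mat_trace (M * M\<^sup>H) = mat_trace (M' * M'\<^sup>H)"
  shows "frobenius_norm M = frobenius_norm M'"
proof -
  have "(of_real ((frobenius_norm M)\<^sup>2) :: 'a) = of_real ((frobenius_norm M')\<^sup>2)"
    using assms(3) frobenius_norm_eq_trace[OF assms(1)] frobenius_norm_eq_trace[OF assms(2)] by simp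
  then show ?thesis
    using frobenius_norm_nonneg by (metis of_real_eq_iff power2_eq_imp_eq)
qed

text \<open>In the product of \<open>M * V\<^sup>H\<close> with its adjoint the inner factor
  \<open>V\<^sup>H * V\<close> cancels.\<close>

lemma frobenius_norm_mult_adjoint_orthonormal:
  assumes M: "(M :: 'a mat) \<in> carrier_mat r k" and V: "V \<in> carrier_mat n k" "V\<^sup>H * V = 1\<^sub>m k"
  shows "frobenius_norm (M * V\<^sup>H) = frobenius_norm M"
proof (rule frobenius_norm_eqI)
  have "(M * V\<^sup>H)\<^sup>H = V * M\<^sup>H"
    using mat_adjoint_mult[of M r k "V\<^sup>H" n] M V(1) by simp
  moreover have "M * V\<^sup>H * (V * M\<^sup>H) = M * (V\<^sup>H * (V * M\<^sup>H))"
    using M V(1) by (intro assoc_mult_mat[of _ r k _ n _ r]) auto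
  moreover have "V\<^sup>H * (V * M\<^sup>H) = V\<^sup>H * V * M\<^sup>H"
    using M V(1) by (intro assoc_mult_mat[symmetric, of _ k n _ k _ r]) auto
  ultimately show "mat_trace (M * V\<^sup>H * (M * V\<^sup>H)\<^sup>H) = mat_trace (M * M\<^sup>H)"
    using M V(2) left_mult_one_mat[of "M\<^sup>H" k r] by simp
qed (use M V(1) in auto)

lemma frobenius_norm_adjoint:
  assumes M: "(M :: 'a mat) \<in> carrier_mat r c"
  shows "frobenius_norm (M\<^sup>H) = frobenius_norm M"
  using mat_trace_comm[of "M\<^sup>H" c r M] M by (intro frobenius_norm_eqI[of _ c r _ r c]) auto

text \<open>The right factor is removed directly, the left one after passing to the adjoint.\<close>

lemma frobenius_norm_orthonormal_sandwich:
  assumes M: "(M :: 'a mat) \<in> carrier_mat k k" and V: "V \<in> carrier_mat n k" "V\<^sup>H * V = 1\<^sub>m k"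
  shows "frobenius_norm (V * M * V\<^sup>H) = frobenius_norm M"
proof -
  have "frobenius_norm (V * M * V\<^sup>H) = frobenius_norm (V * M)"
    using M V by (intro frobenius_norm_mult_adjoint_orthonormal) auto
  also have "\<dots> = frobenius_norm ((V * M)\<^sup>H)"
    using M V by (intro frobenius_norm_adjoint[symmetric]) auto
  also have "(V * M)\<^sup>H = M\<^sup>H * V\<^sup>H"
    by (rule mat_adjoint_mult[OF V(1) M])
  also have "frobenius_norm (M\<^sup>H * V\<^sup>H) = frobenius_norm M"
    using frobenius_norm_mult_adjoint_orthonormal[of "M\<^sup>H" k k V n] M V frobenius_norm_adjoint[OF M]
    by simp
  finally show ?thesis .
qed

text \<open>Expanding the square of the norm of \<open>F - L\<close> and eliminating
  \<open>G\<close> by \<open>sum\<close> shows that this square plus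
  \<open>mat_trace (F * G)\<close> equals the square of the norm of \<open>L\<close>.\<close>

lemma frobenius_norm_minus_le:
  assumes F: "(F :: 'a mat) \<in> carrier_mat n n" "hermitian_mat F"
    and G: "G \<in> carrier_mat n n" and L: "L \<in> carrier_mat n n"
    and sum: "F + G = L + L\<^sup>H" and tr: "0 \<le> mat_trace (F * G)"
  shows "frobenius_norm (F - L) \<le> frobenius_norm L"
proof -
  define K where "K = L\<^sup>H"
  have K: "K \<in> carrier_mat n n"
    using L by (simp add: K_def)
  have "G = L + K - F"
  proof (rule eq_matI)
    fix i j assume "i < dim_row (L + K - F)" "j < dim_col (L + K - F)"
    then show "G $$ (i, j) = (L + K - F) $$ (i, j)"
      using F(1) G L K arg_cong[OF sum[folded K_def], of "\<lambda>M. M $$ (i, j)"]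
      by (simp add: algebra_simps)
  qed (use F G in auto)
  then have "F * G = F * L + F * K - F * F"
    using F(1) L K mult_minus_distrib_mat[of F n n "L + K" n F] mult_add_distrib_mat[of F n n L n K]
    by simp
  then have trFG: "mat_trace (F * G) = mat_trace (F * L) + mat_trace (F * K) - mat_trace (F * F)"
    using F(1) L K mat_trace_minus[of "F * L + F * K" n "F * F"] mat_trace_add[of "F * L" n "F * K"]
    by simp
  have "(F - L)\<^sup>H = F - K"
    using mat_adjoint_minus[OF F(1) L] F(2) by (simp add: K_def hermitian_mat_def)
  then have "of_real ((frobenius_norm (F - L))\<^sup>2) = mat_trace ((F - L) * (F - K))"
    using frobenius_norm_eq_trace[OF minus_carrier_mat[OF L], of F] by simp
  also have "(F - L) * (F - K) = (F * F - F * K) - (L * F - L * K)"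
    using F(1) L K minus_mult_distrib_mat[OF F(1) L minus_carrier_mat[OF K], of F] mult_minus_distrib_mat[of F n n F n K]
      mult_minus_distrib_mat[of L n n F n K] by simp
  also have "mat_trace \<dots> = mat_trace (F * F - F * K) - mat_trace (L * F - L * K)"
    using F(1) L K by (intro mat_trace_minus[of _ n]) auto
  also have "\<dots> = (mat_trace (F * F) - mat_trace (F * K)) - (mat_trace (L * F) - mat_trace (L * K))"
    using F(1) L K mat_trace_minus[of "F * F" n "F * K"] mat_trace_minus[of "L * F" n "L * K"] by simp
  \<comment> \<open>The traces of \<open>F * L\<close> and \<open>L * F\<close> agree, so all terms
    of the expansion containing \<open>F\<close> add up to minus the trace of
    \<open>F * G\<close>.\<close>
  also have "\<dots> = mat_trace (L * K) - mat_trace (F * G)"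
    unfolding trFG using mat_trace_comm[OF F(1) L] by simp
  also have "mat_trace (L * K) = of_real ((frobenius_norm L)\<^sup>2)"
    using frobenius_norm_eq_trace[OF L] by (simp add: K_def)
  finally have eq: "of_real ((frobenius_norm (F - L))\<^sup>2) + mat_trace (F * G)
      = of_real ((frobenius_norm L)\<^sup>2)"
    by simp
  \<comment> \<open>The trace is the image of a nonnegative real, so the identity can be read in the
    reals and the term dropped.\<close>
  obtain t where t: "0 \<le> t" "mat_trace (F * G) = of_real t"
    using nonneg_imp_real[OF tr] by blast
  have "(of_real ((frobenius_norm (F - L))\<^sup>2 + t) :: 'a) = of_real ((frobenius_norm L)\<^sup>2)"
    using eq unfolding t(2) of_real_add .
  then have "(frobenius_norm (F - L))\<^sup>2 \<le> (frobenius_norm L)\<^sup>2"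
    using t(1) unfolding of_real_eq_iff by linarith
  then show ?thesis
    using frobenius_norm_nonneg by (rule power2_le_imp_le)
qed

end

subsection \<open>The error bound\<close>

text \<open>\<open>Wp * Wp\<^sup>H\<close> projects orthogonally onto the span of the first group:
  it fixes \<open>Wp\<^sup>H\<close> from the right and annihilates
  \<open>Wm\<^sup>H\<close>.\<close>

lemma signed_eigendecomp_mult_pos:
  fixes M :: "'a :: conjugatable_ordered_field mat"
  assumes W: "Wp \<in> carrier_mat n p" "Wm \<in> carrier_mat n q"
    and T: "Tp \<in> carrier_mat p p" "Tm \<in> carrier_mat q q"
    and orth: "Wp\<^sup>H * Wp = 1\<^sub>m p" "Wp\<^sup>H * Wm = 0\<^sub>m p q"
  shows "(Wp * Tp * Wp\<^sup>H + Wm * Tm * Wm\<^sup>H) * (Wp * Wp\<^sup>H) = Wp * Tp * Wp\<^sup>H"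
proof -
  have "Wp * Tp * Wp\<^sup>H * (Wp * Wp\<^sup>H) = Wp * Tp * (Wp\<^sup>H * (Wp * Wp\<^sup>H))"
    using W T by (intro assoc_mult_mat[of _ n p _ n _ n]) auto
  also have "Wp\<^sup>H * (Wp * Wp\<^sup>H) = Wp\<^sup>H * Wp * Wp\<^sup>H"
    using W by (intro assoc_mult_mat[symmetric, of _ p n _ p _ n]) auto
  also have "\<dots> = Wp\<^sup>H"
    using W orth by simp
  finally have 1: "Wp * Tp * Wp\<^sup>H * (Wp * Wp\<^sup>H) = Wp * Tp * Wp\<^sup>H" .
  have "Wm * Tm * Wm\<^sup>H * (Wp * Wp\<^sup>H) = Wm * Tm * (Wm\<^sup>H * (Wp * Wp\<^sup>H))"
    using W T by (intro assoc_mult_mat[of _ n q _ n _ n]) auto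
  also have "Wm\<^sup>H * (Wp * Wp\<^sup>H) = Wm\<^sup>H * Wp * Wp\<^sup>H"
    using W by (intro assoc_mult_mat[symmetric, of _ q n _ p _ n]) auto
  also have "\<dots> = 0\<^sub>m q n"
    using W adjoint_mult_swap_zero[OF W orth(2)] by simp
  finally have 2: "Wm * Tm * Wm\<^sup>H * (Wp * Wp\<^sup>H) = 0\<^sub>m n n"
    using W T by simp
  have "(Wp * Tp * Wp\<^sup>H + Wm * Tm * Wm\<^sup>H) * (Wp * Wp\<^sup>H)
      = Wp * Tp * Wp\<^sup>H * (Wp * Wp\<^sup>H) + Wm * Tm * Wm\<^sup>H * (Wp * Wp\<^sup>H)"
    using W T by (intro add_mult_distrib_mat[of _ n n]) auto
  moreover have "Wp * Tp * Wp\<^sup>H \<in> carrier_mat n n"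
    using W T by auto
  ultimately show ?thesis
    unfolding 1 2 by simp
qed

text \<open>The inner factor \<open>V\<^sup>H * W\<close> vanishes. This is the source of all
  vanishing products of positive and negative parts in the estimate.\<close>

lemma sandwich_mult_sandwich_zero:
  assumes V: "V \<in> carrier_mat n p" and W: "W \<in> carrier_mat n q"
    and S: "S \<in> carrier_mat p p" and T: "T \<in> carrier_mat q q" and orth: "V\<^sup>H * W = 0\<^sub>m p q"
  shows "V * S * V\<^sup>H * (W * T * W\<^sup>H) = 0\<^sub>m n n"
proof -
  have WT: "W * T * W\<^sup>H = W * (T * W\<^sup>H)"
    using W T by (intro assoc_mult_mat[of _ n q _ q _ n]) auto
  have "V * S * V\<^sup>H * (W * T * W\<^sup>H) = V * S * (V\<^sup>H * (W * (T * W\<^sup>H)))"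
    unfolding WT using V W S T by (intro assoc_mult_mat[of _ n p _ n _ n]) auto
  also have "V\<^sup>H * (W * (T * W\<^sup>H)) = V\<^sup>H * W * (T * W\<^sup>H)"
    using V W T by (intro assoc_mult_mat[symmetric, of _ p n _ q _ n]) auto
  also have "\<dots> = 0\<^sub>m p n"
    using W T orth by simp
  finally show ?thesis
    using V S by simp
qed

text \<open>Each column of \<open>Vo\<close> lies in the column space and hence in the kernel. With
  orthonormality and \<open>k + (n - k) = n\<close> this makes the concatenation of
  \<open>Vh\<close> and \<open>Vo\<close> unitary.\<close>

lemma adjoint_mult_col_space_kernel_zero:
  fixes Vh :: "'a :: conjugatable_field mat"
  assumes Vh: "Vh \<in> carrier_mat n k" and Vo: "Vo \<in> carrier_mat n m"
    and ker: "vec_space.col_space n Vo = mat_kernel (Vh\<^sup>H)"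
  shows "Vh\<^sup>H * Vo = 0\<^sub>m k m"
proof (rule eq_matI)
  interpret vec_space "TYPE('a)" n .
  fix i j assume "i < dim_row (0\<^sub>m k m)" "j < dim_col (0\<^sub>m k m)"
  then have ij: "i < k" "j < m" by auto
  have "col Vo j \<in> set (cols Vo)"
    using ij Vo by (simp add: cols_def)
  moreover have "set (cols Vo) \<subseteq> carrier_vec n"
    using cols_dim[of Vo] Vo by simp
  ultimately have "col Vo j \<in> col_space Vo"
    unfolding col_space_def by (metis span_mem)
  then have "Vh\<^sup>H *\<^sub>v col Vo j = 0\<^sub>v k"
    using ker mat_kernelD(2)[OF mat_adjoint_carrier[OF Vh]] by simp
  then have "(Vh\<^sup>H *\<^sub>v col Vo j) $ i = 0"
    using ij by simp
  then show "(Vh\<^sup>H * Vo) $$ (i, j) = 0\<^sub>m k m $$ (i, j)"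
    using Vh Vo ij by simp
qed (use Vh Vo in auto)

text \<open>With the complementary projectors \<open>I\<close> and \<open>J\<close> this is the
  splitting of \<open>A\<close> into the diagonal blocks \<open>I * A * I\<close> and
  \<open>J * A * J\<close> and the off-diagonal ones \<open>J * A * I\<close> and
  \<open>I * A * J\<close>; the latter two are \<open>L\<close> and its adjoint.\<close>

lemma compression_decomposition:
  fixes A :: "'a :: conjugatable_ordered_field mat"
  assumes A: "A \<in> carrier_mat n n" "hermitian_mat A"
    and V: "V \<in> carrier_mat n k" and W: "W \<in> carrier_mat n m"
    and unit: "unitary_mat (append_cols_mat V W)"
  defines "S \<equiv> V\<^sup>H * A * V"
  defines "L \<equiv> (A * V - V * S) * V\<^sup>H"
  shows "A = V * S * V\<^sup>H + W * (W\<^sup>H * A * W) * W\<^sup>H + (L + L\<^sup>H)"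
    and "A * (V * V\<^sup>H) = L + V * S * V\<^sup>H"
proof -
  define I where "I = V * V\<^sup>H"
  define J where "J = W * W\<^sup>H"
  have IJ: "I \<in> carrier_mat n n" "J \<in> carrier_mat n n" "I + J = 1\<^sub>m n"
    using V W unitary_append_cols_resolution[OF V W unit] by (auto simp: I_def J_def)
  have S: "S \<in> carrier_mat k k" "S\<^sup>H = S"
    using A V hermitian_sandwich[OF A V] by (auto simp: S_def hermitian_mat_def)
  have IH: "I\<^sup>H = I"
    using mat_adjoint_mult[of V n k "V\<^sup>H" n] V by (simp add: I_def)
  have comp: "U * (U\<^sup>H * A * U) * U\<^sup>H = U * U\<^sup>H * A * (U * U\<^sup>H)"
    if U: "U \<in> carrier_mat n d" for U d
  proof -
    have "U * (U\<^sup>H * A * U) * U\<^sup>H = U * (U\<^sup>H * A) * U * U\<^sup>H"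
      using U A by (subst assoc_mult_mat[of U n d "U\<^sup>H * A" n U d]) auto
    also have "\<dots> = U * (U\<^sup>H * A) * (U * U\<^sup>H)"
      using U A by (intro assoc_mult_mat[of _ n n _ d _ n]) auto
    also have "U * (U\<^sup>H * A) = U * U\<^sup>H * A"
      using U A by (intro assoc_mult_mat[symmetric, of _ n d _ n _ n]) auto
    finally show ?thesis .
  qed
  have Q: "V * S * V\<^sup>H = I * A * I"
    unfolding S_def I_def by (rule comp[OF V])
  have D: "W * (W\<^sup>H * A * W) * W\<^sup>H = J * A * J"
    unfolding J_def by (rule comp[OF W])
  have "L = A * V * V\<^sup>H - V * S * V\<^sup>H"
    unfolding L_def using A V S by (intro minus_mult_distrib_mat[of _ n k]) auto
  also have "A * V * V\<^sup>H = A * I"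
    unfolding I_def using A V by (intro assoc_mult_mat[of _ n n _ k _ n]) auto
  finally have L: "L = A * I - I * A * I"
    unfolding Q .
  have "(A * I)\<^sup>H = I * A"
    using mat_adjoint_mult[OF A(1) IJ(1)] A(2) IH by (simp add: hermitian_mat_def)
  moreover have "(I * A * I)\<^sup>H = I * A * I"
  proof -
    have "(I * A * I)\<^sup>H = I * (I * A)\<^sup>H"
      using mat_adjoint_mult[of "I * A" n n I n] A IJ IH by simp
    also have "(I * A)\<^sup>H = A * I"
      using mat_adjoint_mult[OF IJ(1) A(1)] A(2) IH by (simp add: hermitian_mat_def)
    also have "I * (A * I) = I * A * I"
      using A IJ by (intro assoc_mult_mat[symmetric, of _ n n _ n _ n]) auto
    finally show ?thesis .
  qed
  ultimately have LH: "L\<^sup>H = I * A - I * A * I"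
    unfolding L using A IJ by (subst mat_adjoint_minus[of _ n n]) auto
  have J: "J = 1\<^sub>m n - I"
  proof (rule eq_matI)
    fix i j assume "i < dim_row (1\<^sub>m n - I)" "j < dim_col (1\<^sub>m n - I)"
    then show "J $$ (i, j) = (1\<^sub>m n - I) $$ (i, j)"
      using IJ(1,2) arg_cong[OF IJ(3), of "\<lambda>M. M $$ (i, j)"] by (simp add: algebra_simps)
  qed (use IJ in auto)
  have c: "A * I \<in> carrier_mat n n" "I * A \<in> carrier_mat n n" "I * A * I \<in> carrier_mat n n"
    using A IJ by auto
  have "J * A = A - I * A"
    unfolding J using minus_mult_distrib_mat[of "1\<^sub>m n" n n I A n] A IJ by simp
  then have "J * A * J = (A - I * A) * (1\<^sub>m n - I)"
    by (simp add: J)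
  also have "\<dots> = (A - I * A) * 1\<^sub>m n - (A - I * A) * I"
    using A IJ c by (intro mult_minus_distrib_mat[of _ n n]) auto
  also have "(A - I * A) * 1\<^sub>m n = A - I * A"
    by (rule right_mult_one_mat[OF minus_carrier_mat[OF c(2)]])
  also have "(A - I * A) * I = A * I - I * A * I"
    using A IJ c by (intro minus_mult_distrib_mat[of _ n n]) auto
  finally have JAJ: "J * A * J = (A - I * A) - (A * I - I * A * I)" .
  show "A * (V * V\<^sup>H) = L + V * S * V\<^sup>H"
    unfolding Q L I_def[symmetric] using A(1) IJ(1) by (intro eq_matI) auto
  show "A = V * S * V\<^sup>H + W * (W\<^sup>H * A * W) * W\<^sup>H + (L + L\<^sup>H)"
  proof -
    \<comment> \<open>An entrywise identity, applied with \<open>A\<close> for \<open>B\<close>,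
      \<open>A * I\<close> for \<open>X\<close>, \<open>I * A\<close> for \<open>Y\<close> and
      \<open>I * A * I\<close> for \<open>Z\<close>.\<close>
    have "B = Z + ((B - Y) - (X - Z)) + ((X - Z) + (Y - Z))"
      if "B \<in> carrier_mat n n" "X \<in> carrier_mat n n" "Y \<in> carrier_mat n n" "Z \<in> carrier_mat n n"
      for B X Y Z :: "'a mat"
      using that[THEN carrier_matD(1)] that[THEN carrier_matD(2)] by (intro eq_matI) simp_all
    then show ?thesis
      unfolding Q D JAJ LH unfolding L using A(1) c by metis
  qed
qed

lemma uminus_nonneg: "(a :: 'a :: conjugatable_ordered_field) \<le> 0 \<Longrightarrow> 0 \<le> - a"
  using add_right_mono[of a 0 "- a"] by simp

lemma sandwich_uminus:
  fixes W T :: "'a :: conjugatable_field mat"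
  assumes "W \<in> carrier_mat n p" "T \<in> carrier_mat p p"
  shows "W * (- T) * W\<^sup>H = - (W * T * W\<^sup>H)"
  using assms by (simp add: uminus_mult_right_mat uminus_mult_left_mat)

context inner_field
begin

text \<open>The bound before squaring; it implies the first of the two required inequalities, and
  the second is arithmetic.\<close>

theorem frobenius_norm_spectral_projector_le:
  fixes A :: "'a mat"
  assumes A: "A \<in> carrier_mat n n" "hermitian_mat A"
    and sd: "signed_eigendecomp A Vp Lp Vm Lm"
    and Vh: "Vh \<in> carrier_mat n k" "orthonormal_cols Vh"
    and Lh: "Lh \<in> carrier_mat k k" "psd_mat Lh" "Lh = Vh\<^sup>H * A * Vh"
    and Vo: "Vo \<in> carrier_mat n (n - k)" "orthonormal_cols Vo"
    and ker: "vec_space.col_space n Vo = mat_kernel (Vh\<^sup>H)" and "k \<le> n"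
  shows "frobenius_norm (A * (Vp * Vp\<^sup>H - Vh * Vh\<^sup>H))
    \<le> frobenius_norm (A * Vh - Vh * Lh) + frobenius_norm (psd_proj (Vo\<^sup>H * A * Vo))"
proof -
  have gram: "Vh\<^sup>H * Vh = 1\<^sub>m k" "Vo\<^sup>H * Vo = 1\<^sub>m (n - k)"
    using Vh Vo by (auto simp: orthonormal_cols_def)
  have ho: "Vh\<^sup>H * Vo = 0\<^sub>m k (n - k)"
    by (rule adjoint_mult_col_space_kernel_zero[OF Vh(1) Vo(1) ker])
  have unit: "unitary_mat (append_cols_mat Vh Vo)"
    using unitary_append_cols_iff[OF Vh(1) Vo(1)] gram ho \<open>k \<le> n\<close> by simp
  from A(1) sd obtain p q where V: "Vp \<in> carrier_mat n p" "Vm \<in> carrier_mat n q"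
    and Vpp: "Vp\<^sup>H * Vp = 1\<^sub>m p" and Vpm: "Vp\<^sup>H * Vm = 0\<^sub>m p q"
    and Lp: "Lp \<in> carrier_mat p p" "diagonal_mat Lp" "\<And>i. i < p \<Longrightarrow> 0 < Lp $$ (i, i)"
    and Lm: "Lm \<in> carrier_mat q q" "diagonal_mat Lm" "\<And>i. i < q \<Longrightarrow> Lm $$ (i, i) \<le> 0"
    and A_eq: "A = Vp * Lp * Vp\<^sup>H + Vm * Lm * Vm\<^sup>H"
    by (rule signed_eigendecompD) blast
  have DM: "Vo\<^sup>H * A * Vo \<in> carrier_mat (n - k) (n - k)" "hermitian_mat (Vo\<^sup>H * A * Vo)"
    using A Vo hermitian_sandwich[OF A Vo(1)] by auto
  obtain Wp Tp Wm Tm where sdD: "signed_eigendecomp (Vo\<^sup>H * A * Vo) Wp Tp Wm Tm"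
    and Dp: "psd_proj (Vo\<^sup>H * A * Vo) = Wp * Tp * Wp\<^sup>H"
    by (rule psd_proj_eigendecomp[OF DM])
  from DM(1) sdD obtain p' q' where W: "Wp \<in> carrier_mat (n - k) p'" "Wm \<in> carrier_mat (n - k) q'"
    and Wpm: "Wp\<^sup>H * Wm = 0\<^sub>m p' q'"
    and Tp: "Tp \<in> carrier_mat p' p'" "diagonal_mat Tp" "\<And>i. i < p' \<Longrightarrow> 0 < Tp $$ (i, i)"
    and Tm: "Tm \<in> carrier_mat q' q'" "diagonal_mat Tm" "\<And>i. i < q' \<Longrightarrow> Tm $$ (i, i) \<le> 0"
    and D_eq: "Vo\<^sup>H * A * Vo = Wp * Tp * Wp\<^sup>H + Wm * Tm * Wm\<^sup>H"
    by (rule signed_eigendecompD) blast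
  define P where "P = Vp * Lp * Vp\<^sup>H"
  \<comment> \<open>The sign is moved into the diagonal factor, here and in \<open>C\<close>, so
    that both matrices are positive semidefinite and \<open>A\<close> is
    \<open>P - N\<close>.\<close>
  define N where "N = Vm * (- Lm) * Vm\<^sup>H"
  define Q where "Q = Vh * Lh * Vh\<^sup>H"
  define Z where "Z = Vo * (Wp * Tp * Wp\<^sup>H) * Vo\<^sup>H"
  define C where "C = Vo * (Wm * (- Tm) * Wm\<^sup>H) * Vo\<^sup>H"
  define L where "L = (A * Vh - Vh * Lh) * Vh\<^sup>H"
  have carr [simp]: "P \<in> carrier_mat n n" "N \<in> carrier_mat n n" "Q \<in> carrier_mat n n"
    "Z \<in> carrier_mat n n" "C \<in> carrier_mat n n" "L \<in> carrier_mat n n"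
    using A V Lp Lm Vh Lh(1) Vo W Tp Tm
    by (auto simp: P_def N_def Q_def Z_def C_def L_def)
  have neg: "diagonal_mat (- Lm)" "\<And>i. i < q \<Longrightarrow> 0 \<le> (- Lm) $$ (i, i)"
    "diagonal_mat (- Tm)" "\<And>i. i < q' \<Longrightarrow> 0 \<le> (- Tm) $$ (i, i)"
    using Lm Tm by (auto simp: diagonal_mat_def uminus_nonneg)
  have psd: "psd_mat P" "psd_mat Q" "psd_mat Z" "psd_mat C"
  proof -
    have Lm': "- Lm \<in> carrier_mat q q" and Tm': "- Tm \<in> carrier_mat q' q'"
      using Lm(1) Tm(1) by auto
    note psd_T = psd_diagonal_mat[OF Tp(1,2) less_imp_le[OF Tp(3)]] psd_diagonal_mat[OF Tm' neg(3,4)]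
    have WT: "Wp * Tp * Wp\<^sup>H \<in> carrier_mat (n - k) (n - k)"
      "Wm * (- Tm) * Wm\<^sup>H \<in> carrier_mat (n - k) (n - k)"
      using W Tp(1) Tm' by auto
    show "psd_mat P"
      unfolding P_def
      by (rule psd_mat_sandwich'[OF Lp(1) psd_diagonal_mat[OF Lp(1,2) less_imp_le[OF Lp(3)]] V(1)])
    show "psd_mat Q"
      unfolding Q_def by (rule psd_mat_sandwich'[OF Lh(1,2) Vh(1)])
    show "psd_mat Z"
      unfolding Z_def
      by (rule psd_mat_sandwich'[OF WT(1) psd_mat_sandwich'[OF Tp(1) psd_T(1) W(1)] Vo(1)])
    show "psd_mat C"
      unfolding C_def
      by (rule psd_mat_sandwich'[OF WT(2) psd_mat_sandwich'[OF Tm' psd_T(2) W(2)] Vo(1)])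
  qed
  have trPC: "0 \<le> mat_trace (P * C)"
    unfolding P_def by (rule mat_trace_psd_mult_nonneg[OF Lp(1,2) less_imp_le[OF Lp(3)] V(1) carr(5) psd(4)])
  have QZ: "psd_mat (Q + Z)"
    by (rule psd_mat_add[OF carr(3,4) psd(2,3)])
  \<comment> \<open>\<open>N\<close> comes with a diagonal factorisation, so it has to be the first
    factor in the trace lemma; the product is commuted afterwards.\<close>
  have "0 \<le> mat_trace (N * (Q + Z))"
    unfolding N_def
    by (rule mat_trace_psd_mult_nonneg[OF _ neg(1,2) V(2) _ QZ]) (use Lm in auto)
  then have trBN: "0 \<le> mat_trace ((Q + Z) * N)"
    using mat_trace_comm[of "Q + Z" n n N] by simp
  have PN: "P * N = 0\<^sub>m n n"
    unfolding P_def N_def using Lm(1) by (intro sandwich_mult_sandwich_zero[OF V Lp(1) _ Vpm]) simp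
  \<comment> \<open>\<open>Q\<close> and \<open>C\<close> live on the orthogonal column spaces of
    \<open>Vh\<close> and \<open>Vo\<close>, whereas \<open>Z\<close> and \<open>C\<close> both live
    on that of \<open>Vo\<close> and are separated by the eigenvector groups \<open>Wp\<close> and
    \<open>Wm\<close>.\<close>
  have "Q * C = 0\<^sub>m n n"
    unfolding Q_def C_def using W Tm(1)
    by (intro sandwich_mult_sandwich_zero[OF Vh(1) Vo(1) Lh(1) _ ho]) auto
  moreover have "Z * C = 0\<^sub>m n n"
  proof -
    have "(Vo * Wp)\<^sup>H * (Vo * Wm) = 0\<^sub>m p' q'"
      using gram_mult_orthonormal[OF Vo(1) gram(2) W] Wpm by simp
    then show ?thesis
      unfolding Z_def C_def sandwich_mult[OF Vo(1) W(1) Tp(1), symmetric]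
        sandwich_mult[OF Vo(1) W(2) uminus_carrier_mat[OF Tm(1)], symmetric]
      using Vo W Tp Tm by (intro sandwich_mult_sandwich_zero[of _ n p' _ q']) auto
  qed
  ultimately have BC: "(Q + Z) * C = 0\<^sub>m n n"
    using add_mult_distrib_mat[of Q n n Z C n] by simp
  define F where "F = P - (Q + Z)"
  define G where "G = C - N"
  have F: "F \<in> carrier_mat n n" "hermitian_mat F"
    unfolding F_def by (rule minus_carrier_mat[OF add_carrier_mat[OF carr(4)]])
      (use psd(1) QZ mat_adjoint_minus[of P n n "Q + Z"]
    in \<open>auto simp: psd_mat_def hermitian_mat_def\<close>)
  have G: "G \<in> carrier_mat n n"
    unfolding G_def by (rule minus_carrier_mat[OF carr(2)])
  \<comment> \<open>The two terms with a negative sign, \<open>P * N\<close> and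
    \<open>(Q + Z) * C\<close>, vanish; the two that remain have nonnegative trace.\<close>
  have "F * G = (P * C - P * N) - ((Q + Z) * C - (Q + Z) * N)"
    using minus_mult_distrib_mat[OF _ _ G, of P n "Q + Z"] mult_minus_distrib_mat[of P n n C n N]
      mult_minus_distrib_mat[of "Q + Z" n n C n N]
    by (simp add: F_def G_def)
  also have "\<dots> = P * C + (Q + Z) * N"
    unfolding PN BC using carrier_matD[OF carr(1)] carrier_matD[OF carr(2)] carrier_matD[OF carr(4)]
      carrier_matD[OF carr(5)] by (intro eq_matI) auto
  finally have "mat_trace (F * G) = mat_trace (P * C) + mat_trace ((Q + Z) * N)"
    using mat_trace_add[OF mult_carrier_mat[OF carr(1,5)]
        mult_carrier_mat[OF add_carrier_mat[OF carr(4)] carr(2)], of Q] by simp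
  then have trFG: "0 \<le> mat_trace (F * G)"
    using trPC trBN by (simp add: add_nonneg_nonneg)
  have A_PN: "A = P - N"
    unfolding N_def sandwich_uminus[OF V(2) Lm(1)] A_eq P_def
    using V Lp(1) Lm(1) by (intro eq_matI) auto
  have ZC: "Vo * (Vo\<^sup>H * A * Vo) * Vo\<^sup>H = Z - C"
  proof -
    have DT: "Wp * Tp * Wp\<^sup>H \<in> carrier_mat (n - k) (n - k)"
      "Wm * Tm * Wm\<^sup>H \<in> carrier_mat (n - k) (n - k)"
      using W Tp(1) Tm(1) by auto
    have "C = - (Vo * (Wm * Tm * Wm\<^sup>H) * Vo\<^sup>H)"
      unfolding C_def sandwich_uminus[OF W(2) Tm(1)] by (rule sandwich_uminus[OF Vo(1) DT(2)])
    then show ?thesis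
      unfolding D_eq sandwich_add[OF Vo(1) DT] Z_def[symmetric]
      using Vo(1) DT(2) carr(4) by (intro eq_matI) auto
  qed
  note comp = compression_decomposition[OF A Vh(1) Vo(1) unit, folded Lh(3), folded L_def Q_def, unfolded ZC]
  \<comment> \<open>Equates the two descriptions of \<open>A\<close>, namely \<open>P - N\<close>
    and the splitting along \<open>Vh\<close> and \<open>Vo\<close>, and rearranges.\<close>
  have FG: "F + G = L + L\<^sup>H"
  proof (rule eq_matI)
    fix i j assume "i < dim_row (L + L\<^sup>H)" "j < dim_col (L + L\<^sup>H)"
    then have ij: "i < n" "j < n"
      using carr(6) by auto
    have "(P - N) $$ (i, j) = (Q + (Z - C) + (L + L\<^sup>H)) $$ (i, j)"
      using comp(1) A_PN by simp
    then show "(F + G) $$ (i, j) = (L + L\<^sup>H) $$ (i, j)"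
      using ij carr[THEN carrier_matD(1)] carr[THEN carrier_matD(2)]
      by (simp add: F_def G_def algebra_simps)
  qed (use carrier_matD[OF F(1)] carrier_matD[OF G] carrier_matD[OF carr(6)] in simp_all)
  have FL: "frobenius_norm (F - L) \<le> frobenius_norm L"
    by (rule frobenius_norm_minus_le[OF F G carr(6) FG trFG])
  have "A * (Vp * Vp\<^sup>H - Vh * Vh\<^sup>H) = A * (Vp * Vp\<^sup>H) - A * (Vh * Vh\<^sup>H)"
    using A V Vh by (intro mult_minus_distrib_mat[of _ n n]) auto
  also have "A * (Vp * Vp\<^sup>H) = P"
    unfolding A_eq P_def by (rule signed_eigendecomp_mult_pos[OF V Lp(1) Lm(1) Vpp Vpm])
  \<comment> \<open>\<open>F\<close> subtracts \<open>Z\<close> as well, so \<open>Z\<close> is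
    added back; its norm is the second term of the bound.\<close>
  also have "P - A * (Vh * Vh\<^sup>H) = (F - L) + Z"
    unfolding comp(2) F_def using carr[THEN carrier_matD(1)] carr[THEN carrier_matD(2)]
    by (intro eq_matI) simp_all
  also have "frobenius_norm \<dots> \<le> frobenius_norm (F - L) + frobenius_norm Z"
    by (rule frobenius_norm_triangle[OF minus_carrier_mat[OF carr(6)] carr(4)])
  also have "frobenius_norm Z = frobenius_norm (psd_proj (Vo\<^sup>H * A * Vo))"
    unfolding Z_def Dp using W Tp
    by (intro frobenius_norm_orthonormal_sandwich[OF _ Vo(1) gram(2)]) auto
  also have "frobenius_norm (F - L) \<le> frobenius_norm (A * Vh - Vh * Lh)"
  proof -
    have "A * Vh - Vh * Lh \<in> carrier_mat n k"
      by (rule minus_carrier_mat[OF mult_carrier_mat[OF Vh(1) Lh(1)]])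
    then have "frobenius_norm L = frobenius_norm (A * Vh - Vh * Lh)"
      unfolding L_def by (rule frobenius_norm_mult_adjoint_orthonormal[OF _ Vh(1) gram(1)])
    then show ?thesis
      using FL by simp
  qed
  finally show ?thesis by simp
qed

text \<open>With \<open>r\<close> and \<open>d\<close> the two norms on the right, the middle term
  exceeds the square of \<open>r + d\<close> by the square of \<open>r\<close>, and twice that
  square exceeds the middle term by \<open>2 * r * d\<close> plus the square of
  \<open>d\<close>.\<close>

corollary frobenius_norm_spectral_projector_squared_le:
  fixes A :: "'a mat"
  assumes "k \<le> n"
    and hyps: "A \<in> carrier_mat n n \<and> hermitian_mat A \<and>
        signed_eigendecomp A Vp Lp Vm Lm \<and>
        Vh \<in> carrier_mat n k \<and> orthonormal_cols Vh \<and>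
        Lh \<in> carrier_mat k k \<and> psd_mat Lh \<and> Lh = Vh\<^sup>H * A * Vh \<and>
        Vo \<in> carrier_mat n (n - k) \<and> orthonormal_cols Vo \<and>
        vec_space.col_space n Vo = mat_kernel (Vh\<^sup>H) \<and>
        R = A * Vh - Vh * Lh \<and>
        Dp = psd_proj (Vo\<^sup>H * A * Vo)"
  shows "(frobenius_norm (A * (Vp * Vp\<^sup>H - Vh * Vh\<^sup>H)))\<^sup>2
        \<le> 2 * (frobenius_norm R)\<^sup>2 + 2 * frobenius_norm R * frobenius_norm Dp
            + (frobenius_norm Dp)\<^sup>2 \<and>
      2 * (frobenius_norm R)\<^sup>2 + 2 * frobenius_norm R * frobenius_norm Dp
            + (frobenius_norm Dp)\<^sup>2
        \<le> 2 * (frobenius_norm R + frobenius_norm Dp)\<^sup>2"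
proof -
  define x r d where "x = frobenius_norm (A * (Vp * Vp\<^sup>H - Vh * Vh\<^sup>H))"
    and "r = frobenius_norm R" and "d = frobenius_norm Dp"
  have "x \<le> r + d"
    using hyps unfolding x_def r_def d_def
    by (elim conjE, hypsubst)
      (rule frobenius_norm_spectral_projector_le; (assumption | rule refl | rule \<open>k \<le> n\<close>))
  moreover have nonneg: "0 \<le> x" "0 \<le> r" "0 \<le> d"
    by (simp_all add: x_def r_def d_def frobenius_norm_nonneg)
  ultimately have "x\<^sup>2 \<le> (r + d)\<^sup>2"
    by (intro power_mono)
  then have "x\<^sup>2 \<le> r\<^sup>2 + d\<^sup>2 + 2 * (r * d)"
    unfolding power2_sum mult.assoc .
  moreover have "0 \<le> r * d" "0 \<le> r\<^sup>2" "0 \<le> d\<^sup>2"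
    using nonneg by simp_all
  \<comment> \<open>The squares and the product become the atoms \<open>u\<close>, \<open>w\<close>
    and \<open>t\<close>, which leaves linear arithmetic.\<close>
  moreover have "a \<le> 2 * u + 2 * t + w \<and> 2 * u + 2 * t + w \<le> 2 * (u + w + 2 * t)"
    if "a \<le> u + w + 2 * t" "0 \<le> t" "0 \<le> u" "0 \<le> w" for a t u w :: real
    using that by (intro conjI) (linarith, simp)
  ultimately have "x\<^sup>2 \<le> 2 * r\<^sup>2 + 2 * (r * d) + d\<^sup>2 \<and>
      2 * r\<^sup>2 + 2 * (r * d) + d\<^sup>2 \<le> 2 * (r\<^sup>2 + d\<^sup>2 + 2 * (r * d))"
    by blast
  then show ?thesis
    unfolding x_def[symmetric] r_def[symmetric] d_def[symmetric] power2_sum mult.assoc .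
qed

end

theorem theorem3p1:
  fixes n k :: nat
  assumes "k \<le> n"
  shows
    "(\<forall>(A :: complex mat) Vp Lp Vm Lm Vh Lh Vo R Dp.
        A \<in> carrier_mat n n \<and> hermitian_mat A \<and>
        signed_eigendecomp A Vp Lp Vm Lm \<and>
        Vh \<in> carrier_mat n k \<and> orthonormal_cols Vh \<and>
        Lh \<in> carrier_mat k k \<and> psd_mat Lh \<and> Lh = mat_adjoint Vh * A * Vh \<and>
        Vo \<in> carrier_mat n (n - k) \<and> orthonormal_cols Vo \<and>
        vec_space.col_space n Vo = mat_kernel (mat_adjoint Vh) \<and>
        R = A * Vh - Vh * Lh \<and>
        Dp = psd_proj (mat_adjoint Vo * A * Vo) \<longrightarrow>
      (frobenius_norm (A * (Vp * mat_adjoint Vp - Vh * mat_adjoint Vh)))\<^sup>2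
        \<le> 2 * (frobenius_norm R)\<^sup>2 + 2 * frobenius_norm R * frobenius_norm Dp
            + (frobenius_norm Dp)\<^sup>2 \<and>
      2 * (frobenius_norm R)\<^sup>2 + 2 * frobenius_norm R * frobenius_norm Dp
            + (frobenius_norm Dp)\<^sup>2
        \<le> 2 * (frobenius_norm R + frobenius_norm Dp)\<^sup>2)
     \<and>
     (\<forall>(A :: real mat) Vp Lp Vm Lm Vh Lh Vo R Dp.
        A \<in> carrier_mat n n \<and> hermitian_mat A \<and>
        signed_eigendecomp A Vp Lp Vm Lm \<and>
        Vh \<in> carrier_mat n k \<and> orthonormal_cols Vh \<and>
        Lh \<in> carrier_mat k k \<and> psd_mat Lh \<and> Lh = mat_adjoint Vh * A * Vh \<and>
        Vo \<in> carrier_mat n (n - k) \<and> orthonormal_cols Vo \<and>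
        vec_space.col_space n Vo = mat_kernel (mat_adjoint Vh) \<and>
        R = A * Vh - Vh * Lh \<and>
        Dp = psd_proj (mat_adjoint Vo * A * Vo) \<longrightarrow>
      (frobenius_norm (A * (Vp * mat_adjoint Vp - Vh * mat_adjoint Vh)))\<^sup>2
        \<le> 2 * (frobenius_norm R)\<^sup>2 + 2 * frobenius_norm R * frobenius_norm Dp
            + (frobenius_norm Dp)\<^sup>2 \<and>
      2 * (frobenius_norm R)\<^sup>2 + 2 * frobenius_norm R * frobenius_norm Dp
            + (frobenius_norm Dp)\<^sup>2
        \<le> 2 * (frobenius_norm R + frobenius_norm Dp)\<^sup>2)"
  \<comment> \<open>The two conjuncts are the two interpretations of the locale; the packed
    conjunction of hypotheses matches by assumption.\<close>
  by (rule conjI; (rule allI)+; rule impI;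
      (rule complex.frobenius_norm_spectral_projector_squared_le[OF assms]
        | rule real.frobenius_norm_spectral_projector_squared_le[OF assms]); assumption)

end
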